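(* Let $M$ be a smooth manifold with tangent bundle $\pi:TM\to M$. For $q\ge 2$, the map $$H^q(M)\longrightarrow H^q_{dd_B}(TM),\qquad [\omega]\longmapsto[\pi^*\omega],$$ from de Rham cohomology of $M$ to the Bott-Chern type cohomology of $(TM,d,d_B)$, is well-defined.
   Context: $M$ is a smooth (Hausdorff, second countable) manifold of dimension $m$. A chart $(x^i)$ on $M$ induces the chart $(x^i,v^j)$ on $TM$, with $v^j$ the components of a tangent vector in the basis $\partial/\partial x^j$. The mirror map $B$ is the globally defined endomorphism of $T(TM)$ given in any induced chart by $B=\sum_{j}dx^j\otimes\frac{\partial}{\partial v^j}$. The operator $i_B$ on $\Omega^*(TM)$ is $i_B\omega(X_1,\dots,X_p)=\sum_{k=1}^p\omega(X_1,\dots,BX_k,\dots,X_p)$ (zero on functions), and $d_B:=i_B\circ d-d\circ i_B$. It is a degree $1$ derivation of $\Omega^*(TM)$, $d_B(\alpha\wedge\beta)=d_B\alpha\wedge\beta+(-1)^{\deg\alpha}\alpha\wedge d_B\beta$, with $d_Bf=\frac{\partial f}{\partial v^i}dx^i$ for functions $f$ on $TM$ and $d_Bdx^i=d_Bdv^i=0$; moreover $d_Bd_B=0$ and $dd_B=-d_Bd$. For $q\ge2$, $$H^q_{dd_B}(TM)=\frac{\{\omega\in\Omega^q(TM):\ d\omega=d_B\omega=0\}}{\{dd_B\tau:\ \tau\in\Omega^{q-2}(TM)\}}.$$ *)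

theory Defs
  imports "HOL-Analysis.Analysis" "HOL-Library.Function_Algebras"
begin

section \<open>Smooth maps\<close>

text \<open>On open sets of finite-dimensional spaces \<open>Ck_on k\<close> is the class \<open>C\<^sup>k\<close>: all iterated
  directional derivatives up to order \<open>k\<close> exist and are continuous.\<close>

primrec Ck_on :: "nat \<Rightarrow> ('e::real_normed_vector \<Rightarrow> 'f::real_normed_vector) \<Rightarrow> 'e set \<Rightarrow> bool"
  where
    "Ck_on 0 f S \<longleftrightarrow> continuous_on S f"
  | "Ck_on (Suc k) f S \<longleftrightarrow>
       (\<forall>x\<in>S. f differentiable (at x)) \<and> (\<forall>v. Ck_on k (\<lambda>x. frechet_derivative f (at x) v) S)"

definition smooth_on :: "('e::real_normed_vector \<Rightarrow> 'f::real_normed_vector) \<Rightarrow> 'e set \<Rightarrow> bool"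
  where "smooth_on f S \<longleftrightarrow> (\<forall>k. Ck_on k f S)"


section \<open>Smooth manifolds\<close>

text \<open>A chart is a pair of its domain and its coordinate map; values of the coordinate map outside
  the domain are irrelevant. The coordinates live in a finite-dimensional inner product space
  \<open>'e\<close> of dimension \<open>m\<close>; the class \<open>euclidean_space\<close> is not used because it excludes \<open>m = 0\<close>.\<close>

type_synonym ('p, 'e) chart = "'p set \<times> ('p \<Rightarrow> 'e)"
type_synonym ('p, 'e) atlas = "('p, 'e) chart set"

definition chart_inv :: "('p, 'e) chart \<Rightarrow> 'e \<Rightarrow> 'p"
  where "chart_inv c = inv_into (fst c) (snd c)"

definition carrier_of :: "('p, 'e) atlas \<Rightarrow> 'p set"
  where "carrier_of A = \<Union> (fst ` A)"

definition charts_at :: "('p, 'e) atlas \<Rightarrow> 'p \<Rightarrow> ('p, 'e) chart set"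
  where "charts_at A p = {c \<in> A. p \<in> fst c}"

text \<open>Below, \<open>chart_at\<close> is only used in expressions that do not depend on the chart.\<close>

definition chart_at :: "('p, 'e) atlas \<Rightarrow> 'p \<Rightarrow> ('p, 'e) chart"
  where "chart_at A p = (SOME c. c \<in> charts_at A p)"

locale smooth_manifold =
  fixes m :: nat and X :: "'p topology" and A :: "('p, 'e::real_inner) atlas"
  assumes model_dim: "\<exists>b :: 'e set. finite b \<and> card b = m \<and> independent b \<and> span b = UNIV"
    and Hausdorff: "Hausdorff_space X"
    and second_countable: "second_countable X"
    and cover: "carrier_of A = topspace X"
    and chart_domain: "\<And>c. c \<in> A \<Longrightarrow> openin X (fst c)"
    and chart_image: "\<And>c. c \<in> A \<Longrightarrow> open (snd c ` fst c)"
    and chart_homeo: "\<And>c. c \<in> A \<Longrightarrow>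
      homeomorphic_map (subtopology X (fst c)) (top_of_set (snd c ` fst c)) (snd c)"
    and transition: "\<And>c c'. c \<in> A \<Longrightarrow> c' \<in> A \<Longrightarrow>
      smooth_on (snd c' \<circ> chart_inv c) (snd c ` (fst c \<inter> fst c'))"


section \<open>Tangent vectors and the tangent bundle\<close>

text \<open>A tangent vector at \<open>p\<close> is the family of its components in all charts around \<open>p\<close>, subject
  to the transformation law; for uniqueness it is \<open>0\<close> on all other charts.\<close>

type_synonym ('p, 'e) tvec = "('p, 'e) chart \<Rightarrow> 'e"

definition tangent_space ::
    "('p, 'e::real_normed_vector) atlas \<Rightarrow> 'p \<Rightarrow> ('p, 'e) tvec set"
  where "tangent_space A p = {u.
    (\<forall>c. c \<notin> charts_at A p \<longrightarrow> u c = 0) \<and>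
    (\<forall>c\<in>charts_at A p. \<forall>c'\<in>charts_at A p.
       u c' = frechet_derivative (snd c' \<circ> chart_inv c) (at (snd c p)) (u c))}"

text \<open>The tangent vector at \<open>p\<close> whose component vector in the chart \<open>c\<close> around \<open>p\<close> is \<open>w\<close>.\<close>

definition coord_vec ::
    "('p, 'e::real_normed_vector) atlas \<Rightarrow> ('p, 'e) chart \<Rightarrow> 'p \<Rightarrow> 'e \<Rightarrow> ('p, 'e) tvec"
  where "coord_vec A c p w = (\<lambda>c'. if c' \<in> charts_at A p
    then frechet_derivative (snd c' \<circ> chart_inv c) (at (snd c p)) w else 0)"

definition tangent_bundle ::
    "('p, 'e::real_normed_vector) atlas \<Rightarrow> ('p \<times> ('p, 'e) tvec) set"
  where "tangent_bundle A = (SIGMA p:carrier_of A. tangent_space A p)"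

text \<open>The chart \<open>(x\<^sup>i, v\<^sup>j)\<close> of the tangent bundle induced by a chart \<open>(x\<^sup>i)\<close>. The bundle
  projection is \<open>fst\<close>.\<close>

definition tangent_chart ::
    "('p, 'e::real_normed_vector) atlas \<Rightarrow> ('p, 'e) chart \<Rightarrow> ('p \<times> ('p, 'e) tvec, 'e \<times> 'e) chart"
  where "tangent_chart A c =
    ({z \<in> tangent_bundle A. fst z \<in> fst c}, \<lambda>(p, u). (snd c p, u c))"

definition tangent_atlas ::
    "('p, 'e::real_normed_vector) atlas \<Rightarrow> ('p \<times> ('p, 'e) tvec, 'e \<times> 'e) atlas"
  where "tangent_atlas A = tangent_chart A ` A"

definition pushforward ::
    "('p, 'e::real_normed_vector) atlas \<Rightarrow> ('r, 'f::real_normed_vector) atlas \<Rightarrow> ('p \<Rightarrow> 'r) \<Rightarrow>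
     'p \<Rightarrow> ('p, 'e) tvec \<Rightarrow> ('r, 'f) tvec"
  where "pushforward A A' F p u = (\<lambda>c'. if c' \<in> charts_at A' (F p)
    then let c = chart_at A p in
      frechet_derivative (snd c' \<circ> F \<circ> chart_inv c) (at (snd c p)) (u c)
    else 0)"


section \<open>Differential forms\<close>

text \<open>A form of degree \<open>q\<close> assigns to a point a function on lists of \<open>q\<close> tangent vectors at that
  point. So that equality of forms is equality of functions, it vanishes on all other lists and
  outside the manifold.\<close>

type_synonym ('p, 'e) form = "'p \<Rightarrow> ('p, 'e) tvec list \<Rightarrow> real"

text \<open>For fixed component vectors \<open>ws\<close>, the local expression of a form in the chart \<open>c\<close>.\<close>

definition local_rep ::
    "('p, 'e::real_normed_vector) atlas \<Rightarrow> ('p, 'e) chart \<Rightarrow> ('p, 'e) form \<Rightarrow> 'e list \<Rightarrow> 'e \<Rightarrow> real"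
  where "local_rep A c \<omega> ws x =
    (let p = chart_inv c x in \<omega> p (map (coord_vec A c p) ws))"

definition alternating_form ::
    "('p, 'e::real_normed_vector) tvec set \<Rightarrow> nat \<Rightarrow> (('p, 'e) tvec list \<Rightarrow> real) \<Rightarrow> bool"
  where "alternating_form V q \<phi> \<longleftrightarrow>
    (\<forall>Xs. \<not> (length Xs = q \<and> set Xs \<subseteq> V) \<longrightarrow> \<phi> Xs = 0) \<and>
    (\<forall>Xs u w a b. \<forall>i<q. length Xs = q \<and> set Xs \<subseteq> V \<and> u \<in> V \<and> w \<in> V \<longrightarrow>
       \<phi> (Xs[i := (\<lambda>c. a *\<^sub>R u c + b *\<^sub>R w c)]) = a * \<phi> (Xs[i := u]) + b * \<phi> (Xs[i := w])) \<and>
    (\<forall>Xs. \<not> distinct Xs \<longrightarrow> \<phi> Xs = 0)"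

definition forms :: "('p, 'e::real_normed_vector) atlas \<Rightarrow> nat \<Rightarrow> ('p, 'e) form set"
  where "forms A q = {\<omega>.
    (\<forall>p. p \<notin> carrier_of A \<longrightarrow> \<omega> p = 0) \<and>
    (\<forall>p\<in>carrier_of A. alternating_form (tangent_space A p) q (\<omega> p)) \<and>
    (\<forall>c\<in>A. \<forall>ws. length ws = q \<longrightarrow> smooth_on (local_rep A c \<omega> ws) (snd c ` fst c))}"

definition drop_nth :: "nat \<Rightarrow> 'x list \<Rightarrow> 'x list"
  where "drop_nth i xs = take i xs @ drop (Suc i) xs"

text \<open>The exterior derivative: in the coordinates of a chart, with constant vectors
  \<open>w\<^sub>0, \<dots>, w\<^sub>q\<close>, it is
  \<open>d\<omega>(w\<^sub>0, \<dots>, w\<^sub>q) = \<Sum>\<^sub>i (-1)\<^sup>i \<partial>\<^sub>w\<^sub>i (\<omega>(w\<^sub>0, \<dots>, w\<^sub>i omitted, \<dots>, w\<^sub>q))\<close>.\<close>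

definition ext_deriv :: "('p, 'e::real_normed_vector) atlas \<Rightarrow> ('p, 'e) form \<Rightarrow> ('p, 'e) form"
  where "ext_deriv A \<omega> p Xs =
    (if p \<in> carrier_of A \<and> set Xs \<subseteq> tangent_space A p
     then let c = chart_at A p; ws = map (\<lambda>u. u c) Xs in
       \<Sum>i<length Xs. (-1) ^ i *
         frechet_derivative (local_rep A c \<omega> (drop_nth i ws)) (at (snd c p)) (ws ! i)
     else 0)"

definition pullback ::
    "('p, 'e::real_normed_vector) atlas \<Rightarrow> ('r, 'f::real_normed_vector) atlas \<Rightarrow> ('p \<Rightarrow> 'r) \<Rightarrow>
     ('r, 'f) form \<Rightarrow> ('p, 'e) form"
  where "pullback A A' F \<omega> p Xs =
    (if p \<in> carrier_of A \<and> set Xs \<subseteq> tangent_space A p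
     then \<omega> (F p) (map (pushforward A A' F p) Xs) else 0)"


section \<open>The mirror map and the operators it induces\<close>

text \<open>Every chart of \<open>tangent_atlas A\<close> is an induced chart \<open>(x\<^sup>i, v\<^sup>j)\<close>, so the components of
  a vector tangent to the bundle are pairs \<open>(a, b)\<close>, standing for
  \<open>\<Sum>\<^sub>j a\<^sup>j \<partial>/\<partial>x\<^sup>j + b\<^sup>j \<partial>/\<partial>v\<^sup>j\<close>. The endomorphism \<open>\<Sum>\<^sub>j dx\<^sup>j \<otimes> \<partial>/\<partial>v\<^sup>j\<close> maps \<open>(a, b)\<close> to \<open>(0, a)\<close>.\<close>

definition mirror_map ::
    "('p, 'e::real_normed_vector) atlas \<Rightarrow> 'p \<times> ('p, 'e) tvec \<Rightarrow>
     ('p \<times> ('p, 'e) tvec, 'e \<times> 'e) tvec \<Rightarrow> ('p \<times> ('p, 'e) tvec, 'e \<times> 'e) tvec"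
  where "mirror_map A z U =
    (\<lambda>C. if C \<in> charts_at (tangent_atlas A) z then (0, fst (U C)) else 0)"

definition i_B ::
    "('p, 'e::real_normed_vector) atlas \<Rightarrow> ('p \<times> ('p, 'e) tvec, 'e \<times> 'e) form \<Rightarrow>
     ('p \<times> ('p, 'e) tvec, 'e \<times> 'e) form"
  where "i_B A \<omega> z Us =
    (if z \<in> tangent_bundle A \<and> set Us \<subseteq> tangent_space (tangent_atlas A) z
     then \<Sum>k<length Us. \<omega> z (Us[k := mirror_map A z (Us ! k)]) else 0)"

definition d_B ::
    "('p, 'e::real_normed_vector) atlas \<Rightarrow> ('p \<times> ('p, 'e) tvec, 'e \<times> 'e) form \<Rightarrow>
     ('p \<times> ('p, 'e) tvec, 'e \<times> 'e) form"
  where "d_B A \<omega> =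
    i_B A (ext_deriv (tangent_atlas A) \<omega>) - ext_deriv (tangent_atlas A) (i_B A \<omega>)"


section \<open>Cohomology\<close>

text \<open>Two elements of \<open>Z\<close> are related if they differ by an element of \<open>N\<close>, so that the quotient
  set \<open>Z // mod_rel Z N\<close> is \<open>Z/N\<close>.\<close>

definition mod_rel :: "'v::minus set \<Rightarrow> 'v set \<Rightarrow> ('v \<times> 'v) set"
  where "mod_rel Z N = {(\<omega>, \<omega>'). \<omega> \<in> Z \<and> \<omega>' \<in> Z \<and> \<omega> - \<omega>' \<in> N}"

definition closed_forms :: "('p, 'e::real_normed_vector) atlas \<Rightarrow> nat \<Rightarrow> ('p, 'e) form set"
  where "closed_forms A q = {\<omega> \<in> forms A q. ext_deriv A \<omega> = 0}"

definition exact_forms :: "('p, 'e::real_normed_vector) atlas \<Rightarrow> nat \<Rightarrow> ('p, 'e) form set"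
  where "exact_forms A q = (case q of 0 \<Rightarrow> {0} | Suc r \<Rightarrow> ext_deriv A ` forms A r)"

definition de_rham_rel ::
    "('p, 'e::real_normed_vector) atlas \<Rightarrow> nat \<Rightarrow> (('p, 'e) form \<times> ('p, 'e) form) set"
  where "de_rham_rel A q = mod_rel (closed_forms A q) (exact_forms A q)"

definition de_rham_cohomology ::
    "('p, 'e::real_normed_vector) atlas \<Rightarrow> nat \<Rightarrow> ('p, 'e) form set set"
  where "de_rham_cohomology A q = closed_forms A q // de_rham_rel A q"

definition de_rham_class ::
    "('p, 'e::real_normed_vector) atlas \<Rightarrow> nat \<Rightarrow> ('p, 'e) form \<Rightarrow> ('p, 'e) form set"
  where "de_rham_class A q \<omega> = de_rham_rel A q `` {\<omega>}"

text \<open>The Bott-Chern type cohomology of \<open>(TM, d, d\<^sub>B)\<close>, for degrees \<open>q \<ge> 2\<close>; the atlas \<open>A\<close> is that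
  of \<open>M\<close>.\<close>

definition ddB_closed_forms ::
    "('p, 'e::real_normed_vector) atlas \<Rightarrow> nat \<Rightarrow> ('p \<times> ('p, 'e) tvec, 'e \<times> 'e) form set"
  where "ddB_closed_forms A q =
    {\<omega> \<in> forms (tangent_atlas A) q. ext_deriv (tangent_atlas A) \<omega> = 0 \<and> d_B A \<omega> = 0}"

definition ddB_exact_forms ::
    "('p, 'e::real_normed_vector) atlas \<Rightarrow> nat \<Rightarrow> ('p \<times> ('p, 'e) tvec, 'e \<times> 'e) form set"
  where "ddB_exact_forms A q =
    (\<lambda>\<tau>. ext_deriv (tangent_atlas A) (d_B A \<tau>)) ` forms (tangent_atlas A) (q - 2)"

definition ddB_rel ::
    "('p, 'e::real_normed_vector) atlas \<Rightarrow> nat \<Rightarrow>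
     (('p \<times> ('p, 'e) tvec, 'e \<times> 'e) form \<times> ('p \<times> ('p, 'e) tvec, 'e \<times> 'e) form) set"
  where "ddB_rel A q = mod_rel (ddB_closed_forms A q) (ddB_exact_forms A q)"

definition ddB_cohomology ::
    "('p, 'e::real_normed_vector) atlas \<Rightarrow> nat \<Rightarrow> ('p \<times> ('p, 'e) tvec, 'e \<times> 'e) form set set"
  where "ddB_cohomology A q = ddB_closed_forms A q // ddB_rel A q"

definition ddB_class ::
    "('p, 'e::real_normed_vector) atlas \<Rightarrow> nat \<Rightarrow> ('p \<times> ('p, 'e) tvec, 'e \<times> 'e) form \<Rightarrow>
     ('p \<times> ('p, 'e) tvec, 'e \<times> 'e) form set"
  where "ddB_class A q \<omega> = ddB_rel A q `` {\<omega>}"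

end

theory Submission
  imports Defs
begin

text \<open>
  Write \<open>P\<close> for the pullback of forms along the projection \<open>\<pi> : TM \<rightarrow> M\<close>. Two things have to be shown:
  \<open>P\<close> sends closed forms to forms closed for both \<open>d\<close> and \<open>d\<^sub>B\<close>, and it sends exact forms to
  \<open>d d\<^sub>B\<close>-exact ones.

  The first holds because \<open>P\<close> commutes with \<open>d\<close> (\<open>ext_deriv_pullback\<close>) and because the mirror map
  takes values in vertical vectors, which \<open>\<pi>\<close> kills, so that \<open>i_B\<close> annihilates every pulled back
  form (\<open>i_B_pullback\<close>).

  For the second, a form \<open>\<eta>\<close> of degree \<open>r + 1\<close> on \<open>M\<close> has a contraction with the tautological
  vector, the form \<open>\<tau>\<close> of degree \<open>r\<close> on \<open>TM\<close> whose value at the point \<open>v\<close> of \<open>TM\<close> is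
  \<open>\<tau>\<^sub>v(U\<^sub>1, \<dots>, U\<^sub>r) = \<eta>(v, \<pi>\<^sub>*U\<^sub>1, \<dots>, \<pi>\<^sub>*U\<^sub>r)\<close>. It is linear along the fibres of \<open>TM\<close>, so its derivative in
  the direction of a vertical vector \<open>a\<close> is \<open>\<eta>(a, \<dots>)\<close>. In \<open>i_B d\<tau>\<close> only these vertical derivatives
  survive, and each of the \<open>r + 1\<close> summands of \<open>i_B\<close> puts the missing vector back into \<open>\<eta>\<close>; since
  moreover \<open>i_B \<tau> = 0\<close>, this gives \<open>d\<^sub>B \<tau> = (r + 1) P\<eta>\<close> (\<open>d_B_tautological\<close>). Hence
  \<open>P(d\<eta>) = d(P\<eta>) = d d\<^sub>B (\<tau> / (r + 1))\<close> (\<open>pullback_exact\<close>).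

  All of this is computed in induced charts, but the exterior derivative at a point is evaluated in
  one chosen chart around that point. So the foundation is that \<open>d\<close> has the same expression in every
  chart (\<open>local_rep_ext_deriv\<close>). The reason is the naturality of the coordinate formula under
  smooth maps (\<open>local_d_pullback\<close>): the second derivatives of the map that appear are symmetric and
  cancel in pairs against the alternation of the form. The same naturality, applied to the projection
  \<open>(x, v) \<mapsto> x\<close> in place of a transition map, yields \<open>d P = P d\<close>. To use chart independence on
  the tangent bundle as well, it is proved for any atlas with smooth transition maps
  (\<open>smooth_atlas\<close>), and the induced charts of \<open>TM\<close> are shown to form such an atlas
  (\<open>tangent_atlas_smooth\<close>).

  Finally, the \<open>d d\<^sub>B\<close>-exact forms are a linear subspace (\<open>ddB_exact_lincomb\<close>), so that forms
  differing by one of them have equal classes.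
\<close>

section \<open>Calculus of smooth maps\<close>

lemma frechet_derivative_eqI: "(f has_derivative f') (at x) \<Longrightarrow> frechet_derivative f (at x) = f'"
  using frechet_derivative_at by metis

lemma Ck_on_cong:
  assumes "open S" "\<And>x. x \<in> S \<Longrightarrow> f x = g x" "Ck_on k f S"
  shows "Ck_on k g S"
  using assms(2,3)
proof (induction k arbitrary: f g)
  case 0
  then show ?case using continuous_on_cong by fastforce
next
  case (Suc k)
  have d: "f differentiable (at x)" if "x \<in> S" for x
    using Suc.prems(2) that by simp
  have eq: "frechet_derivative f (at x) = frechet_derivative g (at x)" if "x \<in> S" for x
    using frechet_derivative_transform_within_open[OF d[OF that] assms(1) that] Suc.prems(1) by blast
  have "g differentiable (at x)" if "x \<in> S" for x
    using d[OF that] has_derivative_transform_within_open[OF _ assms(1) that] Suc.prems(1)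
    unfolding differentiable_def by blast
  moreover have "Ck_on k (\<lambda>x. frechet_derivative g (at x) v) S" for v
    using Suc.IH[of "\<lambda>x. frechet_derivative f (at x) v" "\<lambda>x. frechet_derivative g (at x) v"]
      eq Suc.prems(2) by simp
  ultimately show ?case by simp
qed

text \<open>The recursion for \<open>Ck_on\<close> speaks of the chosen derivative \<open>frechet_derivative\<close>; in practice the
  derivative is known by a formula \<open>f'\<close>, on \<open>S\<close> only. This rule lets the calculus rules for
  derivatives be lifted to \<open>Ck_on\<close> by induction.\<close>

lemma Ck_on_SucI:
  assumes "open S" "\<And>x. x \<in> S \<Longrightarrow> (f has_derivative f' x) (at x)"
    and "\<And>v. Ck_on k (\<lambda>x. f' x v) S"
  shows "Ck_on (Suc k) f S"
proof -
  have "Ck_on k (\<lambda>x. frechet_derivative f (at x) v) S" for v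
    by (rule Ck_on_cong[OF assms(1) _ assms(3)[of v]]) (simp add: frechet_derivative_eqI[OF assms(2)])
  then show ?thesis
    using assms(2) by (auto simp: differentiable_def)
qed

lemma Ck_on_Suc_derivative:
  "Ck_on (Suc k) f S \<Longrightarrow> x \<in> S \<Longrightarrow> (f has_derivative frechet_derivative f (at x)) (at x)"
  by (simp add: frechet_derivative_works[symmetric])

lemma Ck_on_Suc_imp: "Ck_on (Suc k) f S \<Longrightarrow> Ck_on k f S"
proof (induction k arbitrary: f)
  case 0
  then have "isCont f x" if "x \<in> S" for x
    using that by (simp add: differentiable_imp_continuous_within)
  then show ?case
    by (simp add: continuous_at_imp_continuous_on)
qed auto

lemma Ck_on_const: "Ck_on k (\<lambda>x. c) S"
  by (induction k arbitrary: c) auto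

lemma Ck_on_bounded_linear:
  assumes "open S" "bounded_linear L"
  shows "Ck_on k L S"
proof (cases k)
  case 0
  then show ?thesis by (simp add: assms(2) linear_continuous_on)
next
  case (Suc k)
  then show ?thesis
    using Ck_on_SucI[OF assms(1), of L "\<lambda>_. L"] bounded_linear_imp_has_derivative[OF assms(2)]
      Ck_on_const by blast
qed

lemma Ck_on_add:
  assumes "open S" "Ck_on k f S" "Ck_on k g S"
  shows "Ck_on k (\<lambda>x. f x + g x) S"
  using assms(2,3)
proof (induction k arbitrary: f g)
  case 0
  then show ?case by (simp add: continuous_on_add)
next
  case (Suc k)
  show ?case
    by (rule Ck_on_SucI[OF assms(1) has_derivative_add])
      (use Suc in \<open>auto intro: Ck_on_Suc_derivative\<close>)
qed

lemma Ck_on_sum: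
  assumes "open S" "\<And>i. i \<in> I \<Longrightarrow> Ck_on k (f i) S"
  shows "Ck_on k (\<lambda>x. \<Sum>i\<in>I. f i x) S"
  using assms(2)
  by (induction I rule: infinite_finite_induct) (auto intro: Ck_on_add[OF assms(1)] Ck_on_const)

lemma Ck_on_scaleR:
  assumes "open S" "Ck_on k f S" "Ck_on k g S"
  shows "Ck_on k (\<lambda>x. f x *\<^sub>R g x) S"
  using assms(2,3)
proof (induction k arbitrary: f g)
  case 0
  then show ?case by (simp add: continuous_on_scaleR)
next
  case (Suc k)
  note imp = Ck_on_Suc_imp[OF Suc.prems(1)] Ck_on_Suc_imp[OF Suc.prems(2)]
  have d: "((\<lambda>x. f x *\<^sub>R g x) has_derivative
      (\<lambda>h. f x *\<^sub>R frechet_derivative g (at x) h + frechet_derivative f (at x) h *\<^sub>R g x)) (at x)"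
    if "x \<in> S" for x
    using that Suc.prems by (intro has_derivative_scaleR) (auto intro: Ck_on_Suc_derivative)
  have k: "Ck_on k (\<lambda>x. f x *\<^sub>R frechet_derivative g (at x) v + frechet_derivative f (at x) v *\<^sub>R g x) S"
    for v
    using Suc.prems imp by (intro Ck_on_add[OF assms(1)] Suc.IH) auto
  show ?case
    by (rule Ck_on_SucI[OF assms(1) d k])
qed

lemma Ck_on_mult:
  fixes f g :: "'e::real_normed_vector \<Rightarrow> real"
  shows "open S \<Longrightarrow> Ck_on k f S \<Longrightarrow> Ck_on k g S \<Longrightarrow> Ck_on k (\<lambda>x. f x * g x) S"
  using Ck_on_scaleR[of S k f g] by simp

lemma Ck_on_Pair:
  assumes "open S" "Ck_on k f S" "Ck_on k g S"
  shows "Ck_on k (\<lambda>x. (f x, g x)) S"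
  using assms(2,3)
proof (induction k arbitrary: f g)
  case 0
  then show ?case by (simp add: continuous_on_Pair)
next
  case (Suc k)
  show ?case
    by (rule Ck_on_SucI[OF assms(1) has_derivative_Pair])
      (use Suc in \<open>auto intro: Ck_on_Suc_derivative\<close>)
qed

text \<open>Composition with a linear inner map suffices here: forms on the tangent bundle depend on the base
  point through the projection \<open>(x, v) \<mapsto> x\<close>, and on the fibre coordinate linearly.\<close>

lemma Ck_on_compose_linear:
  assumes "open S" "open T" "bounded_linear L" "L ` T \<subseteq> S" "Ck_on k f S"
  shows "Ck_on k (\<lambda>x. f (L x)) T"
  using assms(5)
proof (induction k arbitrary: f)
  case 0
  have "continuous_on T L" by (simp add: assms(3) linear_continuous_on)
  then show ?case
    using 0 assms(4) by (auto intro: continuous_on_compose2)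
next
  case (Suc k)
  have d: "((\<lambda>x. f (L x)) has_derivative (\<lambda>h. frechet_derivative f (at (L x)) (L h))) (at x)"
    if "x \<in> T" for x
    by (rule has_derivative_compose[OF bounded_linear_imp_has_derivative[OF assms(3)]
          Ck_on_Suc_derivative[OF Suc.prems]]) (use that assms(4) in auto)
  show ?case
    by (rule Ck_on_SucI[OF assms(2) d]) (use Suc in auto)
qed

lemma smooth_on_derivative:
  "smooth_on f S \<Longrightarrow> x \<in> S \<Longrightarrow> (f has_derivative frechet_derivative f (at x)) (at x)"
  using Ck_on_Suc_derivative unfolding smooth_on_def by blast

lemma smooth_on_frechet: "smooth_on f S \<Longrightarrow> smooth_on (\<lambda>x. frechet_derivative f (at x) v) S"
  unfolding smooth_on_def by (metis Ck_on.simps(2))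

lemma smooth_on_differentiable: "smooth_on f S \<Longrightarrow> x \<in> S \<Longrightarrow> f differentiable (at x)"
  using smooth_on_derivative differentiable_def by blast

lemma smooth_on_cong:
  "open S \<Longrightarrow> (\<And>x. x \<in> S \<Longrightarrow> f x = g x) \<Longrightarrow> smooth_on f S \<Longrightarrow> smooth_on g S"
  unfolding smooth_on_def by (meson Ck_on_cong)

lemma smooth_on_const: "smooth_on (\<lambda>x. c) S"
  by (simp add: smooth_on_def Ck_on_const)

lemma smooth_on_bounded_linear: "open S \<Longrightarrow> bounded_linear L \<Longrightarrow> smooth_on L S"
  by (simp add: smooth_on_def Ck_on_bounded_linear)

lemma smooth_on_add:
  "open S \<Longrightarrow> smooth_on f S \<Longrightarrow> smooth_on g S \<Longrightarrow> smooth_on (\<lambda>x. f x + g x) S"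
  by (simp add: smooth_on_def Ck_on_add)

lemma smooth_on_sum:
  "open S \<Longrightarrow> (\<And>i. i \<in> I \<Longrightarrow> smooth_on (f i) S) \<Longrightarrow> smooth_on (\<lambda>x. \<Sum>i\<in>I. f i x) S"
  by (simp add: smooth_on_def Ck_on_sum)

lemma smooth_on_scaleR:
  "open S \<Longrightarrow> smooth_on f S \<Longrightarrow> smooth_on g S \<Longrightarrow> smooth_on (\<lambda>x. f x *\<^sub>R g x) S"
  by (simp add: smooth_on_def Ck_on_scaleR)

lemma smooth_on_mult:
  fixes f g :: "'e::real_normed_vector \<Rightarrow> real"
  shows "open S \<Longrightarrow> smooth_on f S \<Longrightarrow> smooth_on g S \<Longrightarrow> smooth_on (\<lambda>x. f x * g x) S"
  by (simp add: smooth_on_def Ck_on_mult)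

lemma smooth_on_Pair:
  "open S \<Longrightarrow> smooth_on f S \<Longrightarrow> smooth_on g S \<Longrightarrow> smooth_on (\<lambda>x. (f x, g x)) S"
  by (simp add: smooth_on_def Ck_on_Pair)

lemma smooth_on_compose_fst:
  fixes f :: "'a::real_normed_vector \<Rightarrow> 'c::real_normed_vector"
  assumes "open S" "smooth_on f S"
  shows "smooth_on (\<lambda>z :: 'a \<times> 'b::real_normed_vector. f (fst z)) (S \<times> UNIV)"
proof -
  have "open (S \<times> (UNIV :: 'b set))"
    using assms(1) by (simp add: open_Times)
  from Ck_on_compose_linear[OF assms(1) this bounded_linear_fst, where f = f] show ?thesis
    using assms(2) by (simp add: smooth_on_def)
qed

text \<open>For a function that is affine on a line, the directional derivative is its slope. It evaluates
  vertical derivatives on the tangent bundle, where only the restriction to a fibre is explicit.\<close>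

lemma derivative_along_line:
  assumes "(G has_derivative G') (at p)" and "\<And>s::real. G (p + s *\<^sub>R w) = \<alpha> + s *\<^sub>R \<beta>"
  shows "G' w = \<beta>"
proof -
  have "((\<lambda>s::real. G (p + s *\<^sub>R w)) has_derivative (\<lambda>s. G' (s *\<^sub>R w))) (at 0)"
    by (rule has_derivative_compose[where f = "\<lambda>s. p + s *\<^sub>R w" and g = G])
      (use assms(1) in \<open>auto intro!: derivative_eq_intros\<close>)
  moreover have "((\<lambda>s::real. \<alpha> + s *\<^sub>R \<beta>) has_derivative (\<lambda>s. s *\<^sub>R \<beta>)) (at 0)"
    by (auto intro!: derivative_eq_intros)
  ultimately have "(\<lambda>s::real. G' (s *\<^sub>R w)) = (\<lambda>s. s *\<^sub>R \<beta>)"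
    unfolding assms(2) by (rule has_derivative_unique)
  from fun_cong[OF this, of 1] show ?thesis by simp
qed

section \<open>Symmetry of the second derivative\<close>

text \<open>The second difference of \<open>f\<close> over a parallelogram with sides \<open>h u\<close> and \<open>h v\<close> is, by the mean value
  theorem in each direction, \<open>h\<^sup>2\<close> times a mixed second derivative inside. The second difference is
  symmetric in \<open>u\<close> and \<open>v\<close>, which forces the two mixed derivatives to agree in the limit.\<close>

lemma second_difference_mvt:
  fixes f :: "'e::real_normed_vector \<Rightarrow> real"
  assumes "Ck_on 2 f S" and "h > 0"
    and S: "\<And>s t. 0 \<le> s \<Longrightarrow> s \<le> h \<Longrightarrow> 0 \<le> t \<Longrightarrow> t \<le> h \<Longrightarrow> x + s *\<^sub>R u + t *\<^sub>R v \<in> S"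
  shows "\<exists>s t. 0 < s \<and> s < h \<and> 0 < t \<and> t < h \<and>
    f (x + h *\<^sub>R u + h *\<^sub>R v) - f (x + h *\<^sub>R u) - (f (x + h *\<^sub>R v) - f x) =
    h * h * frechet_derivative (\<lambda>y. frechet_derivative f (at y) u) (at (x + s *\<^sub>R u + t *\<^sub>R v)) v"
proof -
  let ?D = "\<lambda>y. frechet_derivative f (at y)"
  have f1: "(f has_derivative ?D y) (at y)" if "y \<in> S" for y
    using assms(1) that Ck_on_Suc_derivative[of 1 f S y] by (simp add: numeral_2_eq_2)
  have f2: "((\<lambda>y. ?D y u) has_derivative frechet_derivative (\<lambda>y. ?D y u) (at y)) (at y)"
    if "y \<in> S" for y
    using assms(1) that Ck_on_Suc_derivative[of 0 "\<lambda>y. ?D y u" S y] by (simp add: numeral_2_eq_2)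
  \<comment> \<open>The second difference is the increment of \<open>g\<close> over \<open>[0, h]\<close>; the summand \<open>0 *\<^sub>R v\<close> gives both
    terms the same shape.\<close>
  define g where "g s = f (x + s *\<^sub>R u + h *\<^sub>R v) - f (x + s *\<^sub>R u + 0 *\<^sub>R v)" for s
  have "DERIV g s :> ?D (x + s *\<^sub>R u + h *\<^sub>R v) u - ?D (x + s *\<^sub>R u + 0 *\<^sub>R v) u"
    if "0 \<le> s" "s \<le> h" for s
  proof -
    have l: "((\<lambda>s. f (x + s *\<^sub>R u + t *\<^sub>R v)) has_derivative
        (\<lambda>k. ?D (x + s *\<^sub>R u + t *\<^sub>R v) (k *\<^sub>R u))) (at s)" if "0 \<le> t" "t \<le> h" for t
      by (rule has_derivative_compose[where g=f, OF _ f1])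
        (use S \<open>0 \<le> s\<close> \<open>s \<le> h\<close> that in \<open>auto intro!: derivative_eq_intros\<close>)
    have lin: "linear (?D (x + s *\<^sub>R u + t *\<^sub>R v))" if "0 \<le> t" "t \<le> h" for t
      using f1[OF S[OF \<open>0 \<le> s\<close> \<open>s \<le> h\<close> that]] has_derivative_linear by blast
    have "(g has_derivative (\<lambda>k. ?D (x + s *\<^sub>R u + h *\<^sub>R v) (k *\<^sub>R u) -
        ?D (x + s *\<^sub>R u + 0 *\<^sub>R v) (k *\<^sub>R u))) (at s)"
      unfolding g_def using assms(2) by (intro has_derivative_diff l) auto
    then show ?thesis
      unfolding has_field_derivative_def
    proof (rule has_derivative_eq_rhs)
      show "(\<lambda>k. ?D (x + s *\<^sub>R u + h *\<^sub>R v) (k *\<^sub>R u) - ?D (x + s *\<^sub>R u + 0 *\<^sub>R v) (k *\<^sub>R u)) =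
          (*) (?D (x + s *\<^sub>R u + h *\<^sub>R v) u - ?D (x + s *\<^sub>R u + 0 *\<^sub>R v) u)"
        using linear_scale[OF lin[of h]] linear_scale[OF lin[of 0]] \<open>h > 0\<close>
        by (simp add: fun_eq_iff algebra_simps)
    qed
  qed
  from MVT2[OF \<open>h > 0\<close> this] obtain s where s: "0 < s" "s < h" and
    gs: "g h - g 0 = h * (?D (x + s *\<^sub>R u + h *\<^sub>R v) u - ?D (x + s *\<^sub>R u + 0 *\<^sub>R v) u)"
    by auto
  define k where "k t = ?D (x + s *\<^sub>R u + t *\<^sub>R v) u" for t
  let ?E = "\<lambda>t. frechet_derivative (\<lambda>y. ?D y u) (at (x + s *\<^sub>R u + t *\<^sub>R v))"
  have "DERIV k t :> ?E t v" if "0 \<le> t" "t \<le> h" for t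
  proof -
    have i: "x + s *\<^sub>R u + t *\<^sub>R v \<in> S" using S s that by auto
    have l: "(k has_derivative (\<lambda>k. ?E t (k *\<^sub>R v))) (at t)"
      unfolding k_def
      by (rule has_derivative_compose[where f="\<lambda>t. x + s *\<^sub>R u + t *\<^sub>R v" and g="\<lambda>y. ?D y u",
            OF _ f2[OF i]]) (auto intro!: derivative_eq_intros)
    then show ?thesis
      unfolding has_field_derivative_def
      by (rule has_derivative_eq_rhs)
        (simp add: fun_eq_iff linear_scale[OF has_derivative_linear[OF f2[OF i]]])
  qed
  from MVT2[OF \<open>h > 0\<close> this] obtain t where t: "0 < t" "t < h" and kt: "k h - k 0 = h * ?E t v"
    by auto
  have "f (x + h *\<^sub>R u + h *\<^sub>R v) - f (x + h *\<^sub>R u) - (f (x + h *\<^sub>R v) - f x) = g h - g 0"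
    by (simp add: g_def)
  also have "\<dots> = h * (k h - k 0)" using gs by (simp add: k_def)
  finally show ?thesis using s t kt by (intro exI[of _ s] exI[of _ t]) auto
qed

lemma second_derivative_symmetric_real:
  fixes f :: "'e::real_normed_vector \<Rightarrow> real"
  assumes f: "Ck_on 2 f S" and "open S" "x \<in> S"
  shows "frechet_derivative (\<lambda>y. frechet_derivative f (at y) u) (at x) v =
    frechet_derivative (\<lambda>y. frechet_derivative f (at y) v) (at x) u"
proof -
  define E where "E u v y = frechet_derivative (\<lambda>y. frechet_derivative f (at y) u) (at y) v" for u v y
  have c: "isCont (E u v) x" for u v
    using f assms(2,3) by (simp add: numeral_2_eq_2 E_def[abs_def] continuous_on_eq_continuous_at)
  have "\<bar>E u v x - E v u x\<bar> < 2 * e" if "e > 0" for e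
  proof -
    obtain d1 where d1: "d1 > 0" "\<And>y. dist y x < d1 \<Longrightarrow> dist (E u v y) (E u v x) < e"
      using c[of u v] \<open>e > 0\<close> unfolding continuous_at_eps_delta by blast
    obtain d2 where d2: "d2 > 0" "\<And>y. dist y x < d2 \<Longrightarrow> dist (E v u y) (E v u x) < e"
      using c[of v u] \<open>e > 0\<close> unfolding continuous_at_eps_delta by blast
    obtain d3 where d3: "d3 > 0" "ball x d3 \<subseteq> S"
      using assms(2,3) open_contains_ball by blast
    define d where "d = min d1 (min d2 d3)"
    define h where "h = d / (2 * (norm u + norm v + 1))"
    have d: "d > 0" using d1 d2 d3 by (simp add: d_def)
    have p: "norm u + norm v + 1 > 0" by (simp add: add_nonneg_pos)
    then have h: "h > 0" using d by (simp add: h_def)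
    have near: "dist (x + s *\<^sub>R u + t *\<^sub>R v) x < d" if "0 \<le> s" "s \<le> h" "0 \<le> t" "t \<le> h" for s t
    proof -
      have "dist (x + s *\<^sub>R u + t *\<^sub>R v) x \<le> s * norm u + t * norm v"
        using that norm_triangle_ineq[of "s *\<^sub>R u" "t *\<^sub>R v"] by (simp add: dist_norm add.assoc)
      also have "\<dots> \<le> h * norm u + h * norm v"
        using that by (intro add_mono mult_right_mono) auto
      also have "\<dots> \<le> h * (norm u + norm v + 1)" using h by (simp add: algebra_simps)
      also have "\<dots> = d / 2" using p by (simp add: h_def field_simps)
      finally show ?thesis using d by simp
    qed
    have inS: "x + s *\<^sub>R u + t *\<^sub>R v \<in> S" if "0 \<le> s" "s \<le> h" "0 \<le> t" "t \<le> h" for s t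
      using near[OF that] d3 by (auto simp: d_def dist_commute)
    obtain s t where st: "0 < s" "s < h" "0 < t" "t < h" and
      e1: "f (x + h *\<^sub>R u + h *\<^sub>R v) - f (x + h *\<^sub>R u) - (f (x + h *\<^sub>R v) - f x) =
        h * h * E u v (x + s *\<^sub>R u + t *\<^sub>R v)"
      using second_difference_mvt[OF f h inS] unfolding E_def by blast
    have inS': "x + s *\<^sub>R v + t *\<^sub>R u \<in> S" if "0 \<le> s" "s \<le> h" "0 \<le> t" "t \<le> h" for s t
      using inS[OF that(3,4,1,2)] by (simp add: ac_simps)
    obtain s' t' where st': "0 < s'" "s' < h" "0 < t'" "t' < h" and
      e2: "f (x + h *\<^sub>R v + h *\<^sub>R u) - f (x + h *\<^sub>R v) - (f (x + h *\<^sub>R u) - f x) =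
        h * h * E v u (x + s' *\<^sub>R v + t' *\<^sub>R u)"
      using second_difference_mvt[OF f h inS'] unfolding E_def by blast
    have c1: "x + h *\<^sub>R v + h *\<^sub>R u = x + h *\<^sub>R u + h *\<^sub>R v"
      and c2: "x + s' *\<^sub>R v + t' *\<^sub>R u = x + t' *\<^sub>R u + s' *\<^sub>R v"
      by simp_all
    have "h * h * E u v (x + s *\<^sub>R u + t *\<^sub>R v) = h * h * E v u (x + t' *\<^sub>R u + s' *\<^sub>R v)"
      using e1 e2[unfolded c1 c2] by linarith
    then have "E u v (x + s *\<^sub>R u + t *\<^sub>R v) = E v u (x + t' *\<^sub>R u + s' *\<^sub>R v)"
      using h by simp
    moreover have "dist (E u v (x + s *\<^sub>R u + t *\<^sub>R v)) (E u v x) < e"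
      using near[of s t] st by (intro d1) (auto simp: d_def)
    moreover have "dist (E v u (x + t' *\<^sub>R u + s' *\<^sub>R v)) (E v u x) < e"
      using near[of t' s'] st' by (intro d2) (auto simp: d_def)
    ultimately show ?thesis by (auto simp: dist_real_def)
  qed
  from this[of "\<bar>E u v x - E v u x\<bar> / 2"] show ?thesis
    unfolding E_def[symmetric] by (cases "E u v x = E v u x") auto
qed

text \<open>The vector-valued case follows by testing against all \<open>w\<close> with the inner product.\<close>

lemma second_derivative_symmetric:
  fixes f :: "'e::real_normed_vector \<Rightarrow> 'f::real_inner"
  assumes f: "smooth_on f S" and S: "open S" and x: "x \<in> S"
  shows "frechet_derivative (\<lambda>y. frechet_derivative f (at y) u) (at x) v =
    frechet_derivative (\<lambda>y. frechet_derivative f (at y) v) (at x) u"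
    (is "?l = ?r")
proof -
  have c: "?l \<bullet> w = ?r \<bullet> w" for w
  proof -
    have g1: "((\<lambda>y. f y \<bullet> w) has_derivative (\<lambda>h. frechet_derivative f (at y) h \<bullet> w)) (at y)"
      if "y \<in> S" for y
      by (intro has_derivative_inner_left smooth_on_derivative[OF f] that)
    have g2: "((\<lambda>y. frechet_derivative f (at y) a \<bullet> w) has_derivative
        (\<lambda>h. frechet_derivative (\<lambda>y. frechet_derivative f (at y) a) (at y) h \<bullet> w)) (at y)"
      if "y \<in> S" for y a
      by (intro has_derivative_inner_left smooth_on_derivative[OF smooth_on_frechet[OF f]] that)
    have g3: "((\<lambda>y. frechet_derivative (\<lambda>y. f y \<bullet> w) (at y) a) has_derivative
        (\<lambda>h. frechet_derivative (\<lambda>y. frechet_derivative f (at y) a) (at y) h \<bullet> w)) (at y)"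
      if "y \<in> S" for y a
      by (rule has_derivative_transform_within_open[OF g2[OF that] S that])
        (simp add: frechet_derivative_eqI[OF g1])
    have "Ck_on 0 (\<lambda>y. frechet_derivative (\<lambda>y. frechet_derivative f (at y) a) (at y) b) S" for a b
      using smooth_on_frechet[OF smooth_on_frechet[OF f]] unfolding smooth_on_def by blast
    then have c0: "Ck_on 0 (\<lambda>y. frechet_derivative (\<lambda>y. frechet_derivative f (at y) a) (at y) b \<bullet> w) S"
      for a b by (simp add: continuous_on_inner)
    have "Ck_on (Suc 0) (\<lambda>y. frechet_derivative f (at y) a \<bullet> w) S" for a
      by (rule Ck_on_SucI[OF S g2 c0])
    from Ck_on_SucI[OF S g1 this] have "Ck_on (Suc (Suc 0)) (\<lambda>y. f y \<bullet> w) S" .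
    then have "Ck_on 2 (\<lambda>y. f y \<bullet> w) S" by (simp only: numeral_2_eq_2)
    from second_derivative_symmetric_real[OF this S x, of u v]
    show ?thesis by (simp add: frechet_derivative_eqI[OF g3[OF x]])
  qed
  from c[of "?l - ?r"] have "(?l - ?r) \<bullet> (?l - ?r) = 0" by (simp add: inner_diff_left)
  then show ?thesis by simp
qed

section \<open>Finite-dimensional coordinates\<close>

text \<open>The expansion property alone is what is used of an orthonormal basis; unlike \<open>euclidean_space\<close> it
  includes the zero space, with the empty frame.\<close>

definition orthonormal_frame :: "'e::real_inner set \<Rightarrow> bool"
  where "orthonormal_frame B \<longleftrightarrow> finite B \<and> (\<forall>x. (\<Sum>b\<in>B. (x \<bullet> b) *\<^sub>R b) = x)"

lemma orthonormal_frame_exists: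
  assumes "finite (B :: 'e::real_inner set)" "span B = UNIV"
  shows "\<exists>C :: 'e set. orthonormal_frame C"
proof -
  obtain C :: "'e set" where C: "finite C" "span C = UNIV" "pairwise orthogonal C"
    using basis_orthogonal[OF assms(1)] assms(2) by metis
  \<comment> \<open>An orthogonal spanning set may contain \<open>0\<close>, which normalisation leaves at \<open>0\<close>.\<close>
  define n where "n b = (1 / norm b) *\<^sub>R b" for b :: 'e
  have inj: "inj_on n C"
  proof (rule inj_onI, rule ccontr)
    fix a b assume ab: "a \<in> C" "b \<in> C" "n a = n b" "a \<noteq> b"
    then have "orthogonal a b" using C(3) by (auto simp: pairwise_def)
    then have "n a \<bullet> n b = 0" by (simp add: n_def orthogonal_def)
    then have "n a = 0" "n b = 0" using ab(3) by auto
    then show False using ab(4) by (auto simp: n_def)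
  qed
  have "(\<Sum>b\<in>C. (x \<bullet> n b) *\<^sub>R n b) = x" for x
  proof -
    have "x \<in> span C" using C(2) by simp
    then show ?thesis
    proof (induction rule: span_induct_alt)
      case base
      show ?case by simp
    next
      case (step c x y)
      have "(\<Sum>b\<in>C. (c *\<^sub>R x \<bullet> n b) *\<^sub>R n b) = (\<Sum>b\<in>C. if b = x then c *\<^sub>R x else 0)"
      proof (rule sum.cong[OF refl])
        fix b assume b: "b \<in> C"
        show "(c *\<^sub>R x \<bullet> n b) *\<^sub>R n b = (if b = x then c *\<^sub>R x else 0)"
        proof (cases "b = x")
          case True
          then show ?thesis
            by (cases "x = 0") (auto simp: n_def power2_norm_eq_inner[symmetric] power2_eq_square)
        next
          case False
          then have "x \<bullet> b = 0" using C(3) b step(1) by (auto simp: pairwise_def orthogonal_def)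
          then show ?thesis using False by (simp add: n_def)
        qed
      qed
      also have "\<dots> = c *\<^sub>R x" using C(1) step(1) by simp
      finally show ?case
        using step(2) by (simp add: inner_add_left scaleR_add_left sum.distrib)
    qed
  qed
  then have "orthonormal_frame (n ` C)"
    using C(1) inj by (simp add: orthonormal_frame_def sum.reindex)
  then show ?thesis by blast
qed

lemma linear_frame_expansion:
  assumes "orthonormal_frame B" "linear f"
  shows "(\<Sum>b\<in>B. (w \<bullet> b) *\<^sub>R f b) = f w"
proof -
  have "f (\<Sum>b\<in>B. (w \<bullet> b) *\<^sub>R b) = (\<Sum>b\<in>B. (w \<bullet> b) *\<^sub>R f b)"
    using assms(2) by (simp add: linear_sum linear_scale)
  then show ?thesis using assms(1) by (simp add: orthonormal_frame_def)
qed

section \<open>Alternating multilinear functions on lists\<close>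

text \<open>Forms take lists of tangent vectors, so multilinearity is linearity in each slot of a list of
  fixed length; the values on lists of other lengths are unconstrained.\<close>

definition multilinear :: "nat \<Rightarrow> ('e::real_vector list \<Rightarrow> real) \<Rightarrow> bool"
  where "multilinear q F \<longleftrightarrow>
    (\<forall>xs ys. Suc (length xs + length ys) = q \<longrightarrow> linear (\<lambda>w. F (xs @ w # ys)))"

definition alternating :: "nat \<Rightarrow> ('e::real_vector list \<Rightarrow> real) \<Rightarrow> bool"
  where "alternating q F \<longleftrightarrow>
    multilinear q F \<and> (\<forall>xs. length xs = q \<longrightarrow> \<not> distinct xs \<longrightarrow> F xs = 0)"

lemma multilinear_linear:
  "multilinear q F \<Longrightarrow> Suc (length xs + length ys) = q \<Longrightarrow> linear (\<lambda>w. F (xs @ w # ys))"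
  by (simp add: multilinear_def)

lemma multilinear_Cons: "multilinear (Suc q) F \<Longrightarrow> multilinear q (\<lambda>ws. F (w # ws))"
  unfolding multilinear_def
proof (intro allI impI)
  fix xs ys :: "'a list"
  assume F: "\<forall>xs ys. Suc (length xs + length ys) = Suc q \<longrightarrow> linear (\<lambda>w. F (xs @ w # ys))"
    and "Suc (length xs + length ys) = q"
  then show "linear (\<lambda>u. F (w # xs @ u # ys))"
    using F[rule_format, of "w # xs" ys] by simp
qed

text \<open>The usual polarisation: expand the vanishing value on two equal entries \<open>a + b\<close>.\<close>

lemma alternating_swap:
  assumes "alternating q F" "length xs + length ys + length zs + 2 = q"
  shows "F (xs @ a # ys @ b # zs) = - F (xs @ b # ys @ a # zs)"
proof -
  have m: "multilinear q F" and v: "\<And>c. F (xs @ c # ys @ c # zs) = 0"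
    using assms by (auto simp: alternating_def)
  have l1: "linear (\<lambda>w. F (xs @ w # ys @ c # zs))" for c
    using multilinear_linear[OF m, of xs "ys @ c # zs"] assms(2) by simp
  have l2: "linear (\<lambda>w. F (xs @ c # ys @ w # zs))" for c
    using multilinear_linear[OF m, of "xs @ c # ys" zs] assms(2) by simp
  have "F (xs @ (a + b) # ys @ (a + b) # zs) =
      F (xs @ a # ys @ (a + b) # zs) + F (xs @ b # ys @ (a + b) # zs)"
    by (rule linear_add[OF l1])
  moreover have "F (xs @ c # ys @ (a + b) # zs) = F (xs @ c # ys @ a # zs) + F (xs @ c # ys @ b # zs)"
    for c by (rule linear_add[OF l2])
  from this[of a] this[of b] have "F (xs @ a # ys @ (a + b) # zs) = F (xs @ a # ys @ b # zs)"
    "F (xs @ b # ys @ (a + b) # zs) = F (xs @ b # ys @ a # zs)" by (simp_all add: v)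
  ultimately show ?thesis
    using v[of "a + b"] by simp
qed

lemma alternating_move:
  assumes "alternating q F" "Suc (length xs + length ys + length zs) = q"
  shows "F (xs @ a # ys @ zs) = (-1) ^ length ys * F (xs @ ys @ a # zs)"
  using assms(2)
proof (induction ys arbitrary: xs)
  case (Cons y ys)
  have "F (xs @ a # y # ys @ zs) = - F (xs @ y # a # ys @ zs)"
    using alternating_swap[OF assms(1), of xs "[]" "ys @ zs" a y] Cons.prems by simp
  moreover have "F ((xs @ [y]) @ a # ys @ zs) = (-1) ^ length ys * F ((xs @ [y]) @ ys @ a # zs)"
    by (rule Cons.IH) (use Cons.prems in simp)
  ultimately show ?case by simp
qed simp

lemma multilinear_zero:
  assumes "multilinear q F" "length ws = q" "0 \<in> set ws"
  shows "F ws = 0"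
proof -
  obtain xs ys where ws: "ws = xs @ 0 # ys" using assms(3) by (auto simp: in_set_conv_decomp)
  then show ?thesis
    using linear_0[OF multilinear_linear[OF assms(1), of xs ys]] assms(2) by simp
qed

lemma alternating_Cons:
  assumes "alternating (Suc q) F"
  shows "alternating q (\<lambda>ws. F (w # ws))"
  using assms multilinear_Cons[of q F w] by (simp add: alternating_def)

lemma alternating_map:
  fixes F :: "'b::real_vector list \<Rightarrow> real" and L :: "'a::real_vector \<Rightarrow> 'b"
  assumes "alternating q F" "linear L"
  shows "alternating q (\<lambda>ws. F (map L ws))"
  unfolding alternating_def multilinear_def
proof (intro conjI allI impI)
  fix xs ys :: "'a list"
  assume l: "Suc (length xs + length ys) = q"
  have "linear (\<lambda>w. F (map L xs @ w # map L ys))"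
    using assms(1) l by (intro multilinear_linear[where q = q]) (auto simp: alternating_def)
  from linear_compose[OF assms(2) this]
  show "linear (\<lambda>w. F (map L (xs @ w # ys)))" by (simp add: o_def)
next
  fix xs :: "'a list"
  assume "length xs = q" "\<not> distinct xs"
  then show "F (map L xs) = 0" using assms(1) by (auto simp: alternating_def distinct_map)
qed

text \<open>Extending a linear map \<open>N\<close> as a derivation preserves alternation: on a list with two equal entries
  only the summands that change one of them survive, and these two differ by a swap. With the mirror
  map for \<open>N\<close> this is the operator \<open>i_B\<close>.\<close>

lemma alternating_derivation:
  assumes F: "alternating q F" and N: "linear N"
  shows "alternating q (\<lambda>ws. \<Sum>k<length ws. F (ws[k := N (ws ! k)]))"
  unfolding alternating_def multilinear_def
proof (intro conjI allI impI)
  have m: "multilinear q F" using F by (simp add: alternating_def)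
  fix xs ys :: "'a list"
  assume l: "Suc (length xs + length ys) = q"
  have "linear (\<lambda>w. F ((xs @ w # ys)[k := N ((xs @ w # ys) ! k)]))" if "k < q" for k
  proof -
    consider "k < length xs" | "k = length xs" | j where "k = length xs + Suc j"
      by (metis add_Suc_right less_imp_Suc_add linorder_neqE_nat)
    then show ?thesis
    proof cases
      case 1
      then show ?thesis
        using multilinear_linear[OF m, of "xs[k := N (xs ! k)]" ys] l
        by (simp add: list_update_append nth_append)
    next
      case 2
      then show ?thesis
        using linear_compose[OF N multilinear_linear[OF m l]] by (simp add: o_def)
    next
      case 3
      then show ?thesis
        using multilinear_linear[OF m, of xs "ys[j := N (ys ! j)]"] l
        by (simp add: list_update_append nth_append)
    qed
  qed
  then have "linear (\<lambda>w. \<Sum>k<q. F ((xs @ w # ys)[k := N ((xs @ w # ys) ! k)]))"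
    by (intro linear_compose_sum) auto
  then show "linear (\<lambda>w. \<Sum>k<length (xs @ w # ys). F ((xs @ w # ys)[k := N ((xs @ w # ys) ! k)]))"
    using l by simp
next
  fix ws :: "'a list"
  assume l: "length ws = q" and "\<not> distinct ws"
  then obtain xs ys zs u where "ws = xs @ [u] @ ys @ [u] @ zs"
    using not_distinct_decomp by blast
  then have ws: "ws = xs @ u # ys @ u # zs" by simp
  let ?f = "\<lambda>k. F (ws[k := N (ws ! k)])"
  define i j where "i = length xs" and "j = Suc (length xs + length ys)"
  have ij: "i < j" "j < q" using l by (auto simp: i_def j_def ws)
  have nth: "ws ! i = u" "ws ! j = u"
    by (auto simp: ws i_def j_def nth_append)
  have "?f k = 0" if "k < q" "k \<noteq> i" "k \<noteq> j" for k
  proof -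
    have "(ws[k := N (ws ! k)]) ! i = (ws[k := N (ws ! k)]) ! j" using that nth by simp
    then have "\<not> distinct (ws[k := N (ws ! k)])"
      using ij l by (metis distinct_conv_nth length_list_update less_trans nat_neq_iff)
    then show ?thesis using F l by (simp add: alternating_def)
  qed
  then have "(\<Sum>k<length ws. ?f k) = (\<Sum>k\<in>{i, j}. ?f k)"
    using ij l by (intro sum.mono_neutral_right) auto
  also have "\<dots> = ?f i + ?f j" using ij by simp
  also have "?f i = F (xs @ N u # ys @ u # zs)"
    by (simp add: nth) (simp add: ws i_def list_update_append)
  also have "?f j = F (xs @ u # ys @ N u # zs)"
    by (simp add: nth) (simp add: ws j_def list_update_append)
  also have "F (xs @ N u # ys @ u # zs) = - F (xs @ u # ys @ N u # zs)"
    by (rule alternating_swap[OF F]) (use l ws in simp)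
  finally show "(\<Sum>k<length ws. ?f k) = 0" by simp
qed

lemma length_drop_nth: "i < length xs \<Longrightarrow> length (drop_nth i xs) = length xs - 1"
  by (simp add: drop_nth_def min_def)

lemma map_drop_nth: "map f (drop_nth i xs) = drop_nth i (map f xs)"
  by (simp add: drop_nth_def take_map drop_map)

lemma drop_nth_append: "length xs = i \<Longrightarrow> drop_nth i (xs @ y # ys) = xs @ ys"
  by (simp add: drop_nth_def)

lemma nth_in_drop_nth: "k < length xs \<Longrightarrow> k \<noteq> i \<Longrightarrow> xs ! k \<in> set (drop_nth i xs)"
  using nth_mem[of k "take i xs"] nth_mem[of "k - Suc i" "drop (Suc i) xs"]
  by (cases "k < i") (auto simp: drop_nth_def)

text \<open>Pairs \<open>(i, k)\<close> of an omitted vector and a remaining slot \<open>k\<close> come in two kinds, according to whether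
  the vector in slot \<open>k\<close> stands after or before the omitted one. Exchanging the two vectors matches
  \<open>(i, j)\<close> with \<open>(j + 1, i)\<close> for \<open>i \<le> j\<close>. By symmetry of \<open>S\<close> the two arguments then contain the same
  vectors; \<open>S a b\<close> has moved across \<open>j - i\<close> places, and the remaining sign makes the terms cancel.\<close>

lemma alternating_symmetric_pair:
  assumes F: "alternating q F" and S: "\<And>a b. S a b = S b a"
    and len: "length ws = Suc q" and ij: "i \<le> j" "j < q"
  shows "(-1) ^ i * F ((drop_nth i (map J ws))[j := S (ws ! i) (drop_nth i ws ! j)]) +
    (-1) ^ Suc j * F ((drop_nth (Suc j) (map J ws))[i := S (ws ! Suc j) (drop_nth (Suc j) ws ! i)]) = 0"
proof -
  \<comment> \<open>Slot \<open>j\<close> of the list without entry \<open>i \<le> j\<close> is entry \<open>j + 1\<close> of the whole list.\<close>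
  define xs ys zs where "xs = take i ws" and "ys = take (j - i) (drop (Suc i) ws)"
    and "zs = drop (Suc (Suc j)) ws"
  have ws: "ws = xs @ ws ! i # ys @ ws ! Suc j # zs"
  proof -
    have "ws = xs @ ws ! i # drop (Suc i) ws"
      using len ij by (simp add: xs_def id_take_nth_drop[symmetric])
    moreover have "drop (Suc i) ws = ys @ drop (Suc i) ws ! (j - i) # drop (Suc (j - i)) (drop (Suc i) ws)"
      unfolding ys_def using len ij by (intro id_take_nth_drop) simp
    moreover have "drop (Suc (j - i)) (drop (Suc i) ws) = zs"
      using ij by (simp add: zs_def)
    moreover have "drop (Suc i) ws ! (j - i) = ws ! Suc j"
      using len ij by simp
    ultimately show ?thesis by metis
  qed
  define a b where "a = ws ! i" and "b = ws ! Suc j"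
  have lx: "length xs = i" and ly: "length ys = j - i" and lz: "length zs = q - Suc j"
    using len ij by (auto simp: xs_def ys_def zs_def)
  have ws': "ws = xs @ a # ys @ b # zs" using ws by (simp add: a_def b_def)
  have 1: "drop_nth i ws = xs @ ys @ b # zs"
    using drop_nth_append[OF lx, of a "ys @ b # zs"] by (simp add: ws')
  have 2: "drop_nth (Suc j) ws = xs @ a # ys @ zs"
    using drop_nth_append[of "xs @ a # ys" "Suc j" b zs] lx ly ij by (simp add: ws')
  have 3: "drop_nth i ws ! j = b" using ij lx ly by (simp add: 1 nth_append)
  have 4: "drop_nth (Suc j) ws ! i = a" using lx by (simp add: 2 nth_append)
  have "(drop_nth i (map J ws))[j := S a b] = map J xs @ map J ys @ S a b # map J zs"
    using ij lx ly by (simp add: map_drop_nth[symmetric] 1 list_update_append)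
  moreover have "(drop_nth (Suc j) (map J ws))[i := S b a] = map J xs @ S a b # map J ys @ map J zs"
    using lx by (simp add: map_drop_nth[symmetric] 2 list_update_append S[of b a])
  moreover have "F (map J xs @ S a b # map J ys @ map J zs) =
      (-1) ^ (j - i) * F (map J xs @ map J ys @ S a b # map J zs)"
    using alternating_move[OF F, of "map J xs" "map J ys" "map J zs"] lx ly lz ij by simp
  moreover have "(-1) ^ Suc j * (-1) ^ (j - i) = - ((-1) ^ i :: real)"
    using ij by (simp add: power_add[symmetric] flip: minus_one_power_iff) (simp add: minus_one_power_iff)
  ultimately show ?thesis
    by (simp only: 3 4 a_def[symmetric] b_def[symmetric]) (simp add: algebra_simps)
qed

text \<open>The contribution of the second derivatives of a coordinate change to the exterior derivative
  vanishes; this is where symmetry of the second derivative meets alternation.\<close>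

lemma alternating_symmetric_sum:
  assumes F: "alternating q F" and S: "\<And>a b. S a b = S b a" and len: "length ws = Suc q"
  shows "(\<Sum>i<Suc q. (-1) ^ i * (\<Sum>k<q.
    F ((drop_nth i (map J ws))[k := S (ws ! i) (drop_nth i ws ! k)]))) = 0"
proof -
  define t where "t i k = (-1) ^ i * F ((drop_nth i (map J ws))[k := S (ws ! i) (drop_nth i ws ! k)])"
    for i k
  let ?P = "{..<Suc q} \<times> {..<q}"
  let ?L = "{p \<in> ?P. fst p \<le> snd p}" and ?U = "{p \<in> ?P. \<not> fst p \<le> snd p}"
  have "(\<Sum>i<Suc q. (-1) ^ i * (\<Sum>k<q.
      F ((drop_nth i (map J ws))[k := S (ws ! i) (drop_nth i ws ! k)]))) = (\<Sum>i<Suc q. \<Sum>k<q. t i k)"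
    unfolding t_def sum_distrib_left ..
  also have "\<dots> = (\<Sum>(i, k)\<in>?P. t i k)"
    by (simp only: sum.cartesian_product)
  also have "\<dots> = (\<Sum>(i, k)\<in>?L \<union> ?U. t i k)"
    by (rule sum.cong) auto
  also have "\<dots> = (\<Sum>(i, k)\<in>?L. t i k) + (\<Sum>(i, k)\<in>?U. t i k)"
    by (rule sum.union_disjoint) auto
  also have "(\<Sum>(i, k)\<in>?U. t i k) = (\<Sum>(i, k)\<in>?L. t (Suc k) i)"
    by (rule sum.reindex_bij_witness[of _ "\<lambda>(i, k). (Suc k, i)" "\<lambda>(i, k). (k, i - 1)"]) auto
  also have "(\<Sum>(i, k)\<in>?L. t i k) + (\<Sum>(i, k)\<in>?L. t (Suc k) i) = (\<Sum>(i, k)\<in>?L. t i k + t (Suc k) i)"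
    by (simp add: sum.distrib[symmetric] case_prod_unfold)
  also have "\<dots> = 0"
  proof (rule sum.neutral, clarsimp)
    fix i k assume "i \<le> k" "k < q"
    from alternating_symmetric_pair[OF F S len this] show "t i k + t (Suc k) i = 0"
      by (simp only: t_def)
  qed
  finally show ?thesis .
qed


section \<open>The exterior derivative in coordinates\<close>

definition local_d ::
    "('e::real_normed_vector list \<Rightarrow> 'e \<Rightarrow> real) \<Rightarrow> 'e list \<Rightarrow> 'e \<Rightarrow> real"
  where "local_d R ws x = (\<Sum>i<length ws.
    (-1) ^ i * frechet_derivative (R (drop_nth i ws)) (at x) (ws ! i))"

text \<open>The product rule for a multilinear map whose arguments and base point both vary. The family \<open>L\<close> is
  only known to be differentiable for constant arguments, so the first argument is expanded in a
  frame, which reduces the claim to the product rule for real functions and to shorter lists.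
  Multilinearity is required on a neighbourhood \<open>V\<close> only, since local expressions of forms are
  meaningless outside the image of the chart.\<close>

lemma has_derivative_multilinear:
  fixes L :: "'e::real_inner list \<Rightarrow> 'f::real_normed_vector \<Rightarrow> real"
    and T :: "'x::real_normed_vector \<Rightarrow> 'f" and W :: "'a \<Rightarrow> 'x \<Rightarrow> 'e"
  assumes B: "orthonormal_frame (B :: 'e set)"
    and U: "open U" "x \<in> U" and V: "open V" "T ` U \<subseteq> V"
    and T: "(T has_derivative T') (at x)"
    and W: "\<And>a. a \<in> set as \<Longrightarrow> (W a has_derivative W' a) (at x)"
    and L: "\<And>y. y \<in> V \<Longrightarrow> multilinear (length as) (\<lambda>ws. L ws y)"
    and diff: "\<And>ws. length ws = length as \<Longrightarrow> L ws differentiable (at (T x))"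
  shows "((\<lambda>y. L (map (\<lambda>a. W a y) as) (T y)) has_derivative
    (\<lambda>h. frechet_derivative (L (map (\<lambda>a. W a x) as)) (at (T x)) (T' h) +
      (\<Sum>k<length as. L ((map (\<lambda>a. W a x) as)[k := W' (as ! k) h]) (T x)))) (at x)"
  using W L diff
proof (induction as arbitrary: L)
  case Nil
  have "(L [] has_derivative frechet_derivative (L []) (at (T x))) (at (T x))"
    using Nil.prems(3)[of "[]"] by (simp add: frechet_derivative_works[symmetric])
  from has_derivative_compose[OF T this] show ?case by simp
next
  case (Cons a as)
  define r where "r y = map (\<lambda>a. W a y) as" for y
  let ?D = "\<lambda>ws. frechet_derivative (L ws) (at (T x))"
  have lenr: "length (r y) = length as" for y by (simp add: r_def)
  have lin: "linear (\<lambda>w. L (w # ws) y)" if "y \<in> V" "length ws = length as" for ws y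
    using multilinear_linear[OF Cons.prems(2)[OF that(1)], of "[]" ws] that(2) by simp
  have D: "(L ws has_derivative ?D ws) (at (T x))" if "length ws = Suc (length as)" for ws
    using Cons.prems(3)[of ws] that by (simp add: frechet_derivative_works[symmetric])
  have TxV: "T x \<in> V" using U V by blast
  have Dlin: "(\<Sum>b\<in>B. (w \<bullet> b) * ?D (b # ws) h) = ?D (w # ws) h" if "length ws = length as" for w ws h
  proof -
    have "((\<lambda>y. \<Sum>b\<in>B. (w \<bullet> b) * L (b # ws) y) has_derivative
        (\<lambda>h. \<Sum>b\<in>B. (w \<bullet> b) * ?D (b # ws) h)) (at (T x))"
      by (intro has_derivative_sum has_derivative_mult_right D) (simp add: that)
    then have "(L (w # ws) has_derivative (\<lambda>h. \<Sum>b\<in>B. (w \<bullet> b) * ?D (b # ws) h)) (at (T x))"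
      by (rule has_derivative_transform_within_open[OF _ V(1) TxV])
        (use linear_frame_expansion[OF B lin] that in simp)
    then show ?thesis by (simp add: frechet_derivative_eqI)
  qed
  have IH: "((\<lambda>y. L (b # r y) (T y)) has_derivative
      (\<lambda>h. ?D (b # r x) (T' h) + (\<Sum>k<length as. L (b # (r x)[k := W' (as ! k) h]) (T x)))) (at x)" for b
    unfolding r_def
    by (rule Cons.IH[of "\<lambda>ws. L (b # ws)"])
      (use Cons.prems in \<open>auto intro: multilinear_Cons\<close>)
  have Wa: "(W a has_derivative W' a) (at x)" using Cons.prems(1) by simp
  have "((\<lambda>y. \<Sum>b\<in>B. (W a y \<bullet> b) * L (b # r y) (T y)) has_derivative
      (\<lambda>h. \<Sum>b\<in>B. (W a x \<bullet> b) * (?D (b # r x) (T' h) +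
          (\<Sum>k<length as. L (b # (r x)[k := W' (as ! k) h]) (T x))) +
        (W' a h \<bullet> b) * L (b # r x) (T x))) (at x)"
    by (intro has_derivative_sum has_derivative_mult IH has_derivative_inner_left Wa)
  then have d: "((\<lambda>y. L (W a y # r y) (T y)) has_derivative
      (\<lambda>h. \<Sum>b\<in>B. (W a x \<bullet> b) * (?D (b # r x) (T' h) +
          (\<Sum>k<length as. L (b # (r x)[k := W' (as ! k) h]) (T x))) +
        (W' a h \<bullet> b) * L (b # r x) (T x))) (at x)"
    by (rule has_derivative_transform_within_open[OF _ U])
      (use linear_frame_expansion[OF B lin] V(2) lenr in auto)
  have "(\<Sum>b\<in>B. (W a x \<bullet> b) * (?D (b # r x) (T' h) +
        (\<Sum>k<length as. L (b # (r x)[k := W' (as ! k) h]) (T x))) +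
        (W' a h \<bullet> b) * L (b # r x) (T x)) =
      ?D (W a x # r x) (T' h) +
      ((\<Sum>k<length as. L (W a x # (r x)[k := W' (as ! k) h]) (T x)) + L (W' a h # r x) (T x))" for h
  proof -
    have "(\<Sum>b\<in>B. (W a x \<bullet> b) * (\<Sum>k<length as. L (b # (r x)[k := W' (as ! k) h]) (T x))) =
        (\<Sum>k<length as. \<Sum>b\<in>B. (W a x \<bullet> b) * L (b # (r x)[k := W' (as ! k) h]) (T x))"
      unfolding sum_distrib_left by (rule sum.swap)
    also have "\<dots> = (\<Sum>k<length as. L (W a x # (r x)[k := W' (as ! k) h]) (T x))"
      using linear_frame_expansion[OF B lin[OF TxV]] lenr by simp
    finally have 1: "(\<Sum>b\<in>B. (W a x \<bullet> b) * (\<Sum>k<length as. L (b # (r x)[k := W' (as ! k) h]) (T x))) =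
        (\<Sum>k<length as. L (W a x # (r x)[k := W' (as ! k) h]) (T x))" .
    have 2: "(\<Sum>b\<in>B. (W' a h \<bullet> b) * L (b # r x) (T x)) = L (W' a h # r x) (T x)"
      using linear_frame_expansion[OF B lin[OF TxV lenr], of "W' a h"] by simp
    show ?thesis
      by (simp add: distrib_left sum.distrib 1 2 Dlin[OF lenr])
  qed
  then have "((\<lambda>y. L (W a y # r y) (T y)) has_derivative
      (\<lambda>h. ?D (W a x # r x) (T' h) +
      ((\<Sum>k<length as. L (W a x # (r x)[k := W' (as ! k) h]) (T x)) + L (W' a h # r x) (T x)))) (at x)"
    using d by simp
  then show ?case
    by (simp add: r_def sum.lessThan_Suc_shift add_ac del: sum.lessThan_Suc)
qed

text \<open>Naturality of the coordinate formula for \<open>d\<close>. Differentiating \<open>R'\<close> with the arguments \<open>DT w\<close> gives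
  the derivatives of \<open>R'\<close>, which make up the right-hand side, and terms with second derivatives of
  \<open>T\<close>, which cancel. The domain of \<open>T\<close> may be of another dimension than its target, so that the
  lemma covers the projection of the tangent bundle as well as transition maps.\<close>

lemma local_d_pullback:
  fixes R' :: "'e::real_inner list \<Rightarrow> 'e \<Rightarrow> real" and T :: "'x::real_normed_vector \<Rightarrow> 'e"
  assumes B: "orthonormal_frame (B :: 'e set)"
    and U: "open U" "x \<in> U" and V: "open V" "T ` U \<subseteq> V"
    and T: "smooth_on T U"
    and R': "\<And>y. y \<in> V \<Longrightarrow> alternating q (\<lambda>ws. R' ws y)"
    and diff: "\<And>ws. length ws = q \<Longrightarrow> R' ws differentiable (at (T x))"
    and R: "\<And>ws y. y \<in> U \<Longrightarrow> length ws = q \<Longrightarrow>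
      R ws y = R' (map (frechet_derivative T (at y)) ws) (T y)"
    and len: "length ws = Suc q"
  shows "local_d R ws x = local_d R' (map (frechet_derivative T (at x)) ws) (T x)"
proof -
  let ?J = "frechet_derivative T (at x)"
  define H where "H a b = frechet_derivative (\<lambda>y. frechet_derivative T (at y) b) (at x) a" for a b
  have H: "H a b = H b a" for a b
    unfolding H_def by (rule second_derivative_symmetric[OF T U])
  have d: "frechet_derivative (R as) (at x) h = frechet_derivative (R' (map ?J as)) (at (T x)) (?J h) +
      (\<Sum>k<q. R' ((map ?J as)[k := H h (as ! k)]) (T x))" if as: "length as = q" for as h
  proof -
    have "((\<lambda>y. R' (map (\<lambda>a. frechet_derivative T (at y) a) as) (T y)) has_derivative
      (\<lambda>h. frechet_derivative (R' (map (\<lambda>a. ?J a) as)) (at (T x)) (?J h) +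
      (\<Sum>k<length as. R' ((map (\<lambda>a. ?J a) as)[k := H h (as ! k)]) (T x)))) (at x)"
      unfolding H_def
    proof (rule has_derivative_multilinear[OF B U V])
      show "(T has_derivative ?J) (at x)" using smooth_on_derivative[OF T U(2)] .
      show "((\<lambda>y. frechet_derivative T (at y) a) has_derivative
          frechet_derivative (\<lambda>y. frechet_derivative T (at y) a) (at x)) (at x)" for a
        using smooth_on_derivative[OF smooth_on_frechet[OF T] U(2)] .
    qed (use R' diff as in \<open>auto simp: alternating_def\<close>)
    from has_derivative_transform_within_open[OF this U, of "R as"] R as
    have "(R as has_derivative (\<lambda>h. frechet_derivative (R' (map ?J as)) (at (T x)) (?J h) +
      (\<Sum>k<q. R' ((map ?J as)[k := H h (as ! k)]) (T x)))) (at x)" by simp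
    then show ?thesis by (simp add: frechet_derivative_eqI)
  qed
  have alt: "alternating q (\<lambda>ws. R' ws (T x))" using R' U V by blast
  have "local_d R ws x = (\<Sum>i<Suc q. (-1) ^ i *
      (frechet_derivative (R' (drop_nth i (map ?J ws))) (at (T x)) (?J (ws ! i)) +
       (\<Sum>k<q. R' ((drop_nth i (map ?J ws))[k := H (ws ! i) (drop_nth i ws ! k)]) (T x))))"
    unfolding local_d_def len
    by (rule sum.cong[OF refl]) (simp add: d length_drop_nth len map_drop_nth)
  also have "\<dots> = (\<Sum>i<Suc q. (-1) ^ i *
      frechet_derivative (R' (drop_nth i (map ?J ws))) (at (T x)) (?J (ws ! i)))"
  proof -
    have "(\<Sum>i<Suc q. (-1) ^ i * (\<Sum>k<q.
        R' ((drop_nth i (map ?J ws))[k := H (ws ! i) (drop_nth i ws ! k)]) (T x))) = 0"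
      by (rule alternating_symmetric_sum[OF alt H len])
    then show ?thesis unfolding distrib_left sum.distrib by (simp only: add_0_right)
  qed
  also have "\<dots> = local_d R' (map ?J ws) (T x)"
    unfolding local_d_def by (rule sum.cong) (auto simp: len)
  finally show ?thesis .
qed

section \<open>Smooth atlases\<close>

definition chart_jacobian :: "('p, 'e::real_normed_vector) chart \<Rightarrow> ('p, 'e) chart \<Rightarrow> 'p \<Rightarrow> 'e \<Rightarrow> 'e"
  where "chart_jacobian c c' p = frechet_derivative (snd c' \<circ> chart_inv c) (at (snd c p))"

text \<open>What the calculus of forms needs from a smooth manifold, without the topology of the manifold, so
  that the tangent bundle qualifies too. The topology enters only through the openness of overlaps in
  coordinates; the case \<open>c = c'\<close> says that chart images are open.\<close>

locale smooth_atlas =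
  fixes A :: "('p, 'e::real_inner) atlas"
  assumes frame: "\<exists>B :: 'e set. orthonormal_frame B"
    and chart_inj: "\<And>c. c \<in> A \<Longrightarrow> inj_on (snd c) (fst c)"
    and overlap_open: "\<And>c c'. c \<in> A \<Longrightarrow> c' \<in> A \<Longrightarrow> open (snd c ` (fst c \<inter> fst c'))"
    and transition_smooth: "\<And>c c'. c \<in> A \<Longrightarrow> c' \<in> A \<Longrightarrow>
      smooth_on (snd c' \<circ> chart_inv c) (snd c ` (fst c \<inter> fst c'))"

lemma smooth_manifold_imp_smooth_atlas:
  assumes "smooth_manifold m X A"
  shows "smooth_atlas A"
proof -
  interpret smooth_manifold m X A by fact
  show ?thesis
  proof
    show "\<exists>B :: 'b set. orthonormal_frame B"
      using model_dim orthonormal_frame_exists by blast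
  next
    fix c assume "c \<in> A"
    then have "fst c \<subseteq> topspace X" using chart_domain openin_subset by blast
    then show "inj_on (snd c) (fst c)"
      using homeomorphic_imp_injective_map[OF chart_homeo[OF \<open>c \<in> A\<close>]]
      by (simp add: Int_absorb1)
  next
    fix c c' assume c: "c \<in> A" "c' \<in> A"
    have "openin (subtopology X (fst c)) (fst c \<inter> fst c')"
      using chart_domain[OF c(2)] by (auto simp: openin_subtopology)
    then have "openin (top_of_set (snd c ` fst c)) (snd c ` (fst c \<inter> fst c'))"
      using homeomorphic_imp_open_map[OF chart_homeo[OF c(1)]] by (simp add: open_map_def)
    then show "open (snd c ` (fst c \<inter> fst c'))"
      using chart_image[OF c(1)] by (simp add: openin_open_eq)
  qed (fact transition)
qed

lemma chart_at_in:
  assumes "p \<in> carrier_of A"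
  shows "chart_at A p \<in> A" "p \<in> fst (chart_at A p)"
proof -
  have "\<exists>c. c \<in> charts_at A p" using assms by (auto simp: carrier_of_def charts_at_def)
  then have "chart_at A p \<in> charts_at A p" unfolding chart_at_def by (rule someI_ex)
  then show "chart_at A p \<in> A" "p \<in> fst (chart_at A p)" by (auto simp: charts_at_def)
qed

lemma in_carrier: "c \<in> A \<Longrightarrow> p \<in> fst c \<Longrightarrow> p \<in> carrier_of A"
  by (auto simp: carrier_of_def)

text \<open>Forms vanish by convention where they have no meaning; for functions with this property equality can
  be checked in coordinates.\<close>

definition supported :: "('p, 'e::real_normed_vector) atlas \<Rightarrow> ('p, 'e) form \<Rightarrow> bool"
  where "supported A \<omega> \<longleftrightarrow>
    (\<forall>p Xs. \<not> (p \<in> carrier_of A \<and> set Xs \<subseteq> tangent_space A p) \<longrightarrow> \<omega> p Xs = 0)"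

definition lincomb ::
    "real \<Rightarrow> real \<Rightarrow> ('p, 'e) form \<Rightarrow> ('p, 'e) form \<Rightarrow> ('p, 'e) form"
  where "lincomb a b \<omega> \<omega>' = (\<lambda>p Xs. a * \<omega> p Xs + b * \<omega>' p Xs)"

text \<open>The regularity under which the exterior derivative is linear. It is weaker than being a form and is
  the property of \<open>d\<^sub>B \<tau>\<close> from which linearity of \<open>d d\<^sub>B\<close> is derived.\<close>

definition differentiable_form :: "('p, 'e::real_normed_vector) atlas \<Rightarrow> ('p, 'e) form \<Rightarrow> bool"
  where "differentiable_form A \<omega> \<longleftrightarrow>
    (\<forall>c\<in>A. \<forall>ws. \<forall>x\<in>snd c ` fst c. local_rep A c \<omega> ws differentiable (at x))"

lemma supported_ext_deriv: "supported A (ext_deriv A \<omega>)"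
  by (auto simp: supported_def ext_deriv_def)

lemma supported_lincomb: "supported A \<omega> \<Longrightarrow> supported A \<omega>' \<Longrightarrow> supported A (lincomb a b \<omega> \<omega>')"
  by (auto simp: supported_def lincomb_def)

lemma local_rep_lincomb:
  "local_rep A c (lincomb a b \<omega> \<omega>') ws = (\<lambda>x. a * local_rep A c \<omega> ws x + b * local_rep A c \<omega>' ws x)"
  by (simp add: local_rep_def lincomb_def Let_def fun_eq_iff)

lemma differentiable_form_lincomb:
  "differentiable_form A \<omega> \<Longrightarrow> differentiable_form A \<omega>' \<Longrightarrow> differentiable_form A (lincomb a b \<omega> \<omega>')"
  unfolding differentiable_form_def local_rep_lincomb
  by (intro ballI allI differentiable_add differentiable_mult differentiable_const) auto

lemma ext_deriv_lincomb:
  assumes "differentiable_form A \<omega>" "differentiable_form A \<omega>'"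
  shows "ext_deriv A (lincomb a b \<omega> \<omega>') = lincomb a b (ext_deriv A \<omega>) (ext_deriv A \<omega>')"
proof (intro ext)
  fix p Xs
  show "ext_deriv A (lincomb a b \<omega> \<omega>') p Xs = lincomb a b (ext_deriv A \<omega>) (ext_deriv A \<omega>') p Xs"
  proof (cases "p \<in> carrier_of A \<and> set Xs \<subseteq> tangent_space A p")
    case False
    then show ?thesis by (auto simp: ext_deriv_def lincomb_def)
  next
    case True
    define c where "c = chart_at A p"
    have c: "c \<in> A" "p \<in> fst c" using chart_at_in True by (auto simp: c_def)
    have "frechet_derivative (local_rep A c (lincomb a b \<omega> \<omega>') ws) (at (snd c p)) w =
        a * frechet_derivative (local_rep A c \<omega> ws) (at (snd c p)) w +
        b * frechet_derivative (local_rep A c \<omega>' ws) (at (snd c p)) w" for ws w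
    proof -
      have "(local_rep A c \<omega>'' ws has_derivative
          frechet_derivative (local_rep A c \<omega>'' ws) (at (snd c p))) (at (snd c p))"
        if "differentiable_form A \<omega>''" for \<omega>''
        using that c by (simp add: differentiable_form_def frechet_derivative_works[symmetric])
      from has_derivative_add[OF has_derivative_mult_right[OF this[OF assms(1)]]
          has_derivative_mult_right[OF this[OF assms(2)]]]
      have "((\<lambda>x. a * local_rep A c \<omega> ws x + b * local_rep A c \<omega>' ws x) has_derivative
        (\<lambda>w. a * frechet_derivative (local_rep A c \<omega> ws) (at (snd c p)) w +
          b * frechet_derivative (local_rep A c \<omega>' ws) (at (snd c p)) w)) (at (snd c p))" .
      from frechet_derivative_eqI[OF this] show ?thesis
        by (simp add: local_rep_lincomb)
    qed
    then show ?thesis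
      using True by (simp add: ext_deriv_def lincomb_def Let_def c_def[symmetric] sum.distrib
          sum_distrib_left distrib_left mult_ac)
  qed
qed

context smooth_atlas
begin

lemma chart_image_open: "c \<in> A \<Longrightarrow> open (snd c ` fst c)"
  using overlap_open[of c c] by simp

lemma chart_inv_chart [simp]: "c \<in> A \<Longrightarrow> p \<in> fst c \<Longrightarrow> chart_inv c (snd c p) = p"
  by (simp add: chart_inv_def chart_inj)

lemma chart_jacobian_has_derivative:
  assumes "c \<in> A" "c' \<in> A" "p \<in> fst c" "p \<in> fst c'"
  shows "((snd c' \<circ> chart_inv c) has_derivative chart_jacobian c c' p) (at (snd c p))"
  unfolding chart_jacobian_def
  by (rule smooth_on_derivative[OF transition_smooth]) (use assms in auto)

lemma chart_jacobian_linear: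
  "c \<in> A \<Longrightarrow> c' \<in> A \<Longrightarrow> p \<in> fst c \<Longrightarrow> p \<in> fst c' \<Longrightarrow> linear (chart_jacobian c c' p)"
  using chart_jacobian_has_derivative has_derivative_linear by blast

lemma chart_jacobian_self:
  assumes "c \<in> A" "p \<in> fst c"
  shows "chart_jacobian c c p w = w"
proof -
  have "((snd c \<circ> chart_inv c) has_derivative (\<lambda>w. w)) (at (snd c p))"
    by (rule has_derivative_transform_within_open[OF has_derivative_ident chart_image_open])
      (use assms in auto)
  then show ?thesis by (simp add: chart_jacobian_def frechet_derivative_eqI)
qed

text \<open>The chain rule, applied on the part of the overlap where all three coordinate systems are defined.\<close>

lemma chart_jacobian_cocycle:
  assumes c: "c \<in> A" "c' \<in> A" "c'' \<in> A" and p: "p \<in> fst c" "p \<in> fst c'" "p \<in> fst c''"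
  shows "chart_jacobian c c'' p w = chart_jacobian c' c'' p (chart_jacobian c c' p w)"
proof -
  have "((snd c'' \<circ> chart_inv c') has_derivative chart_jacobian c' c'' p)
      (at ((snd c' \<circ> chart_inv c) (snd c p)))"
    using chart_jacobian_has_derivative[OF c(2,3) p(2,3)] c p by simp
  from diff_chain_at[OF chart_jacobian_has_derivative[OF c(1,2) p(1,2)] this]
  have d: "((snd c'' \<circ> chart_inv c') \<circ> (snd c' \<circ> chart_inv c) has_derivative
      chart_jacobian c' c'' p \<circ> chart_jacobian c c' p) (at (snd c p))" .
  have "((snd c'' \<circ> chart_inv c) has_derivative chart_jacobian c' c'' p \<circ> chart_jacobian c c' p) (at (snd c p))"
    by (rule has_derivative_transform_within_open[OF d overlap_open[OF c(1,2)]])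
      (use c p in auto)
  from frechet_derivative_eqI[OF this] show ?thesis by (simp add: chart_jacobian_def)
qed

lemma coord_vec_eq: "coord_vec A c p w = (\<lambda>c'. if c' \<in> charts_at A p then chart_jacobian c c' p w else 0)"
  unfolding coord_vec_def chart_jacobian_def ..

lemma coord_vec_apply:
  "c' \<in> A \<Longrightarrow> p \<in> fst c' \<Longrightarrow> coord_vec A c p w c' = chart_jacobian c c' p w"
  by (simp add: coord_vec_eq charts_at_def)

lemma coord_vec_self [simp]: "c \<in> A \<Longrightarrow> p \<in> fst c \<Longrightarrow> coord_vec A c p w c = w"
  by (simp add: coord_vec_apply chart_jacobian_self)

lemma coord_vec_tangent [simp]:
  assumes "c \<in> A" "p \<in> fst c"
  shows "coord_vec A c p w \<in> tangent_space A p"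
proof -
  have law: "coord_vec A c p w c'' = chart_jacobian c' c'' p (coord_vec A c p w c')"
    if "c' \<in> charts_at A p" "c'' \<in> charts_at A p" for c' c''
    using that assms chart_jacobian_cocycle[of c c' c'' p w] by (simp add: coord_vec_eq charts_at_def)
  have zero: "coord_vec A c p w c' = 0" if "c' \<notin> charts_at A p" for c'
    using that by (simp add: coord_vec_eq)
  show ?thesis
    unfolding tangent_space_def mem_Collect_eq chart_jacobian_def[symmetric] using law zero by blast
qed

lemma tangent_jacobian:
  "u \<in> tangent_space A p \<Longrightarrow> c \<in> A \<Longrightarrow> c' \<in> A \<Longrightarrow> p \<in> fst c \<Longrightarrow> p \<in> fst c' \<Longrightarrow>
    u c' = chart_jacobian c c' p (u c)"
  unfolding tangent_space_def charts_at_def chart_jacobian_def by blast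

text \<open>A tangent vector is determined by its components in any one chart. Together with
  \<open>coord_vec_self\<close> this makes \<open>coord_vec A c p\<close> an isomorphism onto the tangent space.\<close>

lemma coord_vec_components [simp]:
  assumes "u \<in> tangent_space A p" "c \<in> A" "p \<in> fst c"
  shows "coord_vec A c p (u c) = u"
proof
  fix c'
  show "coord_vec A c p (u c) c' = u c'"
  proof (cases "c' \<in> charts_at A p")
    case True
    then show ?thesis
      using tangent_jacobian[OF assms(1,2) _ assms(3), of c'] by (auto simp: coord_vec_eq charts_at_def)
  next
    case False
    moreover from this have "u c' = 0" using assms(1) unfolding tangent_space_def by blast
    ultimately show ?thesis by (simp add: coord_vec_eq)
  qed
qed

lemma tangent_eqI:
  "u \<in> tangent_space A p \<Longrightarrow> u' \<in> tangent_space A p \<Longrightarrow> c \<in> A \<Longrightarrow> p \<in> fst c \<Longrightarrow> u c = u' c \<Longrightarrow> u = u'"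
  by (metis coord_vec_components)

lemma coord_vec_change:
  assumes "c \<in> A" "c' \<in> A" "p \<in> fst c" "p \<in> fst c'"
  shows "coord_vec A c p w = coord_vec A c' p (chart_jacobian c c' p w)"
  by (rule tangent_eqI[of _ p _ c']) (use assms in \<open>auto simp: coord_vec_apply chart_jacobian_self\<close>)

lemma coord_vec_linear:
  assumes "c \<in> A" "p \<in> fst c"
  shows "coord_vec A c p (a *\<^sub>R u + b *\<^sub>R w) =
    (\<lambda>c'. a *\<^sub>R coord_vec A c p u c' + b *\<^sub>R coord_vec A c p w c')"
  using chart_jacobian_linear[OF assms(1) _ assms(2)]
  by (auto simp: coord_vec_eq charts_at_def linear_add linear_scale)

section \<open>Local expressions of forms\<close>

lemma local_rep_at:
  "c \<in> A \<Longrightarrow> p \<in> fst c \<Longrightarrow> local_rep A c \<omega> ws (snd c p) = \<omega> p (map (coord_vec A c p) ws)"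
  by (simp add: local_rep_def)

lemma form_at:
  assumes "c \<in> A" "p \<in> fst c" "set Xs \<subseteq> tangent_space A p"
  shows "\<omega> p Xs = local_rep A c \<omega> (map (\<lambda>u. u c) Xs) (snd c p)"
proof -
  have "map (coord_vec A c p) (map (\<lambda>u. u c) Xs) = Xs"
    using assms by (auto intro!: map_idI)
  then show ?thesis using assms by (simp only: local_rep_at)
qed

lemma local_rep_change:
  assumes "c \<in> A" "c' \<in> A" "p \<in> fst c" "p \<in> fst c'"
  shows "local_rep A c \<omega> ws (snd c p) = local_rep A c' \<omega> (map (chart_jacobian c c' p) ws) (snd c' p)"
proof -
  have "map (coord_vec A c p) ws = map (coord_vec A c' p) (map (chart_jacobian c c' p) ws)"
    using coord_vec_change[OF assms] by simp
  then show ?thesis using assms by (simp only: local_rep_at)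
qed

lemma form_eqI:
  assumes "supported A \<omega>" "supported A \<omega>'"
    and "\<And>c p ws. c \<in> A \<Longrightarrow> p \<in> fst c \<Longrightarrow>
      local_rep A c \<omega> ws (snd c p) = local_rep A c \<omega>' ws (snd c p)"
  shows "\<omega> = \<omega>'"
proof (intro ext)
  fix p Xs
  show "\<omega> p Xs = \<omega>' p Xs"
  proof (cases "p \<in> carrier_of A \<and> set Xs \<subseteq> tangent_space A p")
    case True
    then show ?thesis
      using chart_at_in[of p A] assms(3)[of "chart_at A p" p]
        form_at[of "chart_at A p" p Xs \<omega>] form_at[of "chart_at A p" p Xs \<omega>'] by simp
  next
    case False
    then show ?thesis using assms(1,2) unfolding supported_def by metis
  qed
qed

lemma forms_supported: "\<omega> \<in> forms A q \<Longrightarrow> supported A \<omega>"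
  unfolding supported_def
proof (intro allI impI)
  fix p Xs
  assume \<omega>: "\<omega> \<in> forms A q" and n: "\<not> (p \<in> carrier_of A \<and> set Xs \<subseteq> tangent_space A p)"
  show "\<omega> p Xs = 0"
  proof (cases "p \<in> carrier_of A")
    case True
    then have "alternating_form (tangent_space A p) q (\<omega> p)" using \<omega> by (simp add: forms_def)
    then show ?thesis using n True unfolding alternating_form_def by blast
  next
    case False
    then show ?thesis using \<omega> by (simp add: forms_def)
  qed
qed

lemma forms_length:
  assumes "\<omega> \<in> forms A q" "length Xs \<noteq> q"
  shows "\<omega> p Xs = 0"
  using assms by (cases "p \<in> carrier_of A") (auto simp: forms_def alternating_form_def)

lemma local_rep_length: "\<omega> \<in> forms A q \<Longrightarrow> length ws \<noteq> q \<Longrightarrow> local_rep A c \<omega> ws = (\<lambda>x. 0)"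
  by (auto simp: local_rep_def Let_def fun_eq_iff intro!: forms_length)

lemma forms_smooth:
  assumes "\<omega> \<in> forms A q" "c \<in> A"
  shows "smooth_on (local_rep A c \<omega> ws) (snd c ` fst c)"
proof (cases "length ws = q")
  case True
  then show ?thesis using assms by (simp add: forms_def)
next
  case False
  then show ?thesis using assms(1) by (simp add: local_rep_length smooth_on_const)
qed

lemma forms_differentiable: "\<omega> \<in> forms A q \<Longrightarrow> differentiable_form A \<omega>"
  unfolding differentiable_form_def using forms_smooth smooth_on_differentiable by blast

lemma forms_alternating:
  assumes \<omega>: "\<omega> \<in> forms A q" and c: "c \<in> A" "y \<in> snd c ` fst c"
  shows "alternating q (\<lambda>ws. local_rep A c \<omega> ws y)"
proof -
  obtain p where p: "p \<in> fst c" "y = snd c p" using c by blast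
  have pc: "p \<in> carrier_of A" using c p by (simp add: in_carrier)
  have a: "alternating_form (tangent_space A p) q (\<omega> p)"
    using \<omega> pc by (simp add: forms_def)
  let ?v = "coord_vec A c p"
  have lin_form: "\<omega> p (Xs[i := (\<lambda>c'. a *\<^sub>R u c' + b *\<^sub>R w c')]) =
      a * \<omega> p (Xs[i := u]) + b * \<omega> p (Xs[i := w])"
    if "i < q" "length Xs = q" "set Xs \<subseteq> tangent_space A p"
      "u \<in> tangent_space A p" "w \<in> tangent_space A p" for Xs u w a b i
    using a that unfolding alternating_form_def by simp
  have lin: "\<omega> p (map ?v (xs @ (a *\<^sub>R u + b *\<^sub>R w) # ys)) =
      a * \<omega> p (map ?v (xs @ u # ys)) + b * \<omega> p (map ?v (xs @ w # ys))"
    if "Suc (length xs + length ys) = q" for xs ys a b u w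
  proof -
    have "length xs < q" "length (map ?v (xs @ 0 # ys)) = q"
      "set (map ?v (xs @ 0 # ys)) \<subseteq> tangent_space A p"
      using that c p by auto
    then have "\<omega> p ((map ?v (xs @ 0 # ys))[length xs := (\<lambda>c'. a *\<^sub>R ?v u c' + b *\<^sub>R ?v w c')]) =
      a * \<omega> p ((map ?v (xs @ 0 # ys))[length xs := ?v u]) +
      b * \<omega> p ((map ?v (xs @ 0 # ys))[length xs := ?v w])"
      by (rule lin_form) (use c p in auto)
    then show ?thesis
      by (simp add: list_update_append coord_vec_linear[OF c(1) p(1)])
  qed
  have "linear (\<lambda>w. \<omega> p (map ?v (xs @ w # ys)))" if "Suc (length xs + length ys) = q" for xs ys
    using lin[OF that, of 1 _ 1] lin[OF that, of _ _ 0]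
    by (intro linearI) auto
  moreover have "\<omega> p (map ?v xs) = 0" if "\<not> distinct xs" for xs
    using a that by (auto simp: alternating_form_def distinct_map)
  ultimately show ?thesis
    by (simp only: alternating_def multilinear_def p(2) local_rep_at[OF c(1) p(1)]) blast
qed

text \<open>A form can be recognised in coordinates: the alternating multilinear conditions on tangent vectors
  are equivalent, through the components in a chart, to those on coordinate vectors.\<close>

lemma formsI:
  assumes s: "supported A \<omega>" and len: "\<And>p Xs. length Xs \<noteq> q \<Longrightarrow> \<omega> p Xs = 0"
    and alt: "\<And>c p. c \<in> A \<Longrightarrow> p \<in> fst c \<Longrightarrow> alternating q (\<lambda>ws. local_rep A c \<omega> ws (snd c p))"
    and sm: "\<And>c ws. c \<in> A \<Longrightarrow> length ws = q \<Longrightarrow> smooth_on (local_rep A c \<omega> ws) (snd c ` fst c)"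
  shows "\<omega> \<in> forms A q"
proof -
  have "alternating_form (tangent_space A p) q (\<omega> p)" if pc: "p \<in> carrier_of A" for p
  proof -
    define c where "c = chart_at A p"
    have c: "c \<in> A" "p \<in> fst c" using chart_at_in pc by (auto simp: c_def)
    note alt = alt[OF c]
    let ?F = "\<lambda>ws. local_rep A c \<omega> ws (snd c p)"
    have at: "\<omega> p Xs = ?F (map (\<lambda>u. u c) Xs)" if "set Xs \<subseteq> tangent_space A p" for Xs
      by (rule form_at[OF c that])
    show ?thesis unfolding alternating_form_def
    proof (intro conjI allI impI)
      fix Xs assume "\<not> (length Xs = q \<and> set Xs \<subseteq> tangent_space A p)"
      then show "\<omega> p Xs = 0" using s len unfolding supported_def by metis
    next
      fix Xs u w and a b :: real and i
      assume i: "i < q" and *: "length Xs = q \<and> set Xs \<subseteq> tangent_space A p \<and>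
        u \<in> tangent_space A p \<and> w \<in> tangent_space A p"
      have comb: "(\<lambda>c'. a *\<^sub>R u c' + b *\<^sub>R w c') \<in> tangent_space A p"
        using coord_vec_linear[OF c, of a "u c" b "w c", symmetric] c * by simp
      have upd: "\<omega> p (Xs[i := z]) =
          ?F (take i (map (\<lambda>u. u c) Xs) @ z c # drop (Suc i) (map (\<lambda>u. u c) Xs))"
        if "z \<in> tangent_space A p" for z
      proof -
        have "set (Xs[i := z]) \<subseteq> tangent_space A p"
          using * that set_update_subset_insert[of Xs i z] by blast
        from at[OF this] show ?thesis
          using * i by (simp add: map_update upd_conv_take_nth_drop take_map drop_map)
      qed
      have L: "linear (\<lambda>z. ?F (take i (map (\<lambda>u. u c) Xs) @ z # drop (Suc i) (map (\<lambda>u. u c) Xs)))"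
        by (rule multilinear_linear[where q = q]) (use alt * i in \<open>auto simp: alternating_def\<close>)
      show "\<omega> p (Xs[i := (\<lambda>c'. a *\<^sub>R u c' + b *\<^sub>R w c')]) =
          a * \<omega> p (Xs[i := u]) + b * \<omega> p (Xs[i := w])"
        using * comb linear_add[OF L, of "a *\<^sub>R u c" "b *\<^sub>R w c"]
          linear_scale[OF L, of a "u c"] linear_scale[OF L, of b "w c"] by (simp add: upd)
    next
      fix Xs :: "('p, 'e) tvec list" assume d: "\<not> distinct Xs"
      show "\<omega> p Xs = 0"
      proof (cases "length Xs = q \<and> set Xs \<subseteq> tangent_space A p")
        case True
        then show ?thesis
          using at[of Xs] alt d by (auto simp: alternating_def distinct_map)
      next
        case False
        then show ?thesis using s len unfolding supported_def by metis
      qed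
    qed
  qed
  then show ?thesis using s sm by (auto simp: forms_def supported_def fun_eq_iff)
qed

lemma local_d_length:
  assumes "\<omega> \<in> forms A q" "length ws \<noteq> Suc q"
  shows "local_d (local_rep A c \<omega>) ws x = 0"
  unfolding local_d_def
proof (rule sum.neutral, rule ballI)
  fix i assume "i \<in> {..<length ws}"
  then have "length (drop_nth i ws) \<noteq> q" using assms(2) by (auto simp: length_drop_nth)
  then show "(-1) ^ i * frechet_derivative (local_rep A c \<omega> (drop_nth i ws)) (at x) (ws ! i) = 0"
    by (simp add: local_rep_length[OF assms(1)])
qed

text \<open>The exterior derivative at \<open>p\<close> is defined in the chart chosen at \<open>p\<close>, which varies with \<open>p\<close> without
  any regularity. Naturality under the transition map to the chart \<open>c\<close> shows that one chart serves a
  whole neighbourhood, which is what makes it possible to differentiate \<open>d\<omega>\<close> again.\<close>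

theorem local_rep_ext_deriv:
  assumes \<omega>: "\<omega> \<in> forms A q" and c: "c \<in> A" "p \<in> fst c"
  shows "local_rep A c (ext_deriv A \<omega>) ws (snd c p) = local_d (local_rep A c \<omega>) ws (snd c p)"
proof -
  define c0 where "c0 = chart_at A p"
  have pc: "p \<in> carrier_of A" using c by (rule in_carrier)
  have c0: "c0 \<in> A" "p \<in> fst c0" using chart_at_in pc by (auto simp: c0_def)
  let ?J = "chart_jacobian c c0 p"
  have comp: "map (\<lambda>u. u c0) (map (coord_vec A c p) ws) = map ?J ws"
    using c0 by (simp add: coord_vec_apply)
  have "local_rep A c (ext_deriv A \<omega>) ws (snd c p) = ext_deriv A \<omega> p (map (coord_vec A c p) ws)"
    by (rule local_rep_at[OF c])
  also have "\<dots> = local_d (local_rep A c0 \<omega>) (map ?J ws) (snd c0 p)"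
    using pc c by (simp only: ext_deriv_def c0_def[symmetric] comp Let_def local_d_def length_map)
      (auto intro!: sum.cong)
  also have "\<dots> = local_d (local_rep A c \<omega>) ws (snd c p)"
  proof (cases "length ws = Suc q")
    case False
    then show ?thesis by (simp add: local_d_length[OF \<omega>])
  next
    case True
    obtain B :: "'e set" where B: "orthonormal_frame B" using frame by blast
    let ?T = "snd c0 \<circ> chart_inv c" and ?U = "snd c ` (fst c \<inter> fst c0)"
    have "local_d (local_rep A c \<omega>) ws (snd c p) =
        local_d (local_rep A c0 \<omega>) (map (frechet_derivative ?T (at (snd c p))) ws) (?T (snd c p))"
    proof (rule local_d_pullback[OF B overlap_open[OF c(1) c0(1)] _ chart_image_open[OF c0(1)] _
          transition_smooth[OF c(1) c0(1)] forms_alternating[OF \<omega> c0(1)] _ _ True])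
      show "snd c p \<in> ?U" using c c0 by blast
      show "?T ` ?U \<subseteq> snd c0 ` fst c0" using c by auto
      show "local_rep A c0 \<omega> ws differentiable (at (?T (snd c p)))" for ws
        using smooth_on_differentiable[OF forms_smooth[OF \<omega> c0(1)]] c c0 by simp
      show "local_rep A c \<omega> ws y = local_rep A c0 \<omega> (map (frechet_derivative ?T (at y)) ws) (?T y)"
        if "y \<in> ?U" for ws y
        using that local_rep_change[OF c(1) c0(1), of _ \<omega> ws] c by (auto simp: chart_jacobian_def)
    qed auto
    then show ?thesis using c by (simp add: chart_jacobian_def)
  qed
  finally show ?thesis .
qed

lemma ext_deriv_differentiable:
  assumes "\<omega> \<in> forms A q"
  shows "differentiable_form A (ext_deriv A \<omega>)"
  unfolding differentiable_form_def
proof (intro ballI allI)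
  fix c ws x assume c: "c \<in> A" "x \<in> snd c ` fst c"
  have "smooth_on (\<lambda>x. \<Sum>i<length ws. (-1) ^ i *
      frechet_derivative (local_rep A c \<omega> (drop_nth i ws)) (at x) (ws ! i)) (snd c ` fst c)"
    by (intro smooth_on_sum smooth_on_mult smooth_on_const smooth_on_frechet forms_smooth[OF assms]
        chart_image_open c)
  then have "smooth_on (local_rep A c (ext_deriv A \<omega>) ws) (snd c ` fst c)"
    by (rule smooth_on_cong[OF chart_image_open[OF c(1)], rotated])
      (auto simp: local_rep_ext_deriv[OF assms c(1)] local_d_def)
  then show "local_rep A c (ext_deriv A \<omega>) ws differentiable (at x)"
    using c(2) by (rule smooth_on_differentiable)
qed

lemma alternating_lincomb:
  assumes "alternating q F" "alternating q G"
  shows "alternating q (\<lambda>ws. a * F ws + b * G ws)"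
  using assms unfolding alternating_def multilinear_def
  by (auto intro!: linear_compose_add linear_compose_scale_right[where 'b=real, simplified])

lemma lincomb_forms:
  assumes "\<omega> \<in> forms A q" "\<omega>' \<in> forms A q"
  shows "lincomb a b \<omega> \<omega>' \<in> forms A q"
proof (rule formsI)
  show "supported A (lincomb a b \<omega> \<omega>')"
    using assms by (intro supported_lincomb forms_supported)
  show "lincomb a b \<omega> \<omega>' p Xs = 0" if "length Xs \<noteq> q" for p Xs
    using assms that by (simp add: lincomb_def forms_length)
  show "alternating q (\<lambda>ws. local_rep A c (lincomb a b \<omega> \<omega>') ws (snd c p))"
    if "c \<in> A" "p \<in> fst c" for c p
    unfolding local_rep_lincomb
    using that assms by (intro alternating_lincomb forms_alternating) auto
  show "smooth_on (local_rep A c (lincomb a b \<omega> \<omega>') ws) (snd c ` fst c)" if "c \<in> A" for c ws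
    unfolding local_rep_lincomb
    using that assms
    by (intro smooth_on_add smooth_on_mult smooth_on_const forms_smooth chart_image_open) auto
qed

lemma local_rep_zero: "local_rep A c 0 ws = (\<lambda>x. 0)"
  by (simp add: local_rep_def fun_eq_iff)

lemma zero_forms: "0 \<in> forms A q"
  by (rule formsI)
    (auto simp: supported_def local_rep_zero alternating_def multilinear_def linear_iff
      smooth_on_const)

lemma ext_deriv_zero: "ext_deriv A 0 = 0"
  by (rule ext)+ (simp add: ext_deriv_def local_rep_zero Let_def)

end

section \<open>The tangent bundle as a manifold\<close>

lemma orthonormal_frame_product:
  assumes "orthonormal_frame (B :: 'e::real_inner set)"
  shows "\<exists>C :: ('e \<times> 'e) set. orthonormal_frame C"
proof (rule orthonormal_frame_exists)
  let ?S = "(\<lambda>b. (b, 0)) ` B \<union> (\<lambda>b. (0, b)) ` B"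
  show "finite ?S" using assms by (simp add: orthonormal_frame_def)
  have "z \<in> span ?S" for z :: "'e \<times> 'e"
  proof -
    have "(\<Sum>b\<in>B. (fst z \<bullet> b) *\<^sub>R (b, 0)) + (\<Sum>b\<in>B. (snd z \<bullet> b) *\<^sub>R (0, b)) \<in> span ?S"
      by (intro span_add span_sum span_scale) (auto intro: span_base)
    moreover have "(\<Sum>b\<in>B. (fst z \<bullet> b) *\<^sub>R (b, 0)) + (\<Sum>b\<in>B. (snd z \<bullet> b) *\<^sub>R (0, b)) = z"
      using assms by (intro prod_eqI) (simp_all add: orthonormal_frame_def fst_sum snd_sum)
    ultimately show ?thesis by simp
  qed
  then show "span ?S = UNIV" by blast
qed

lemma tangent_chart_domain:
  "z \<in> fst (tangent_chart A c) \<longleftrightarrow> z \<in> tangent_bundle A \<and> fst z \<in> fst c"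
  by (simp add: tangent_chart_def)

lemma tangent_chart_map: "snd (tangent_chart A c) z = (snd c (fst z), snd z c)"
  by (simp add: tangent_chart_def case_prod_unfold)

lemma tangent_bundle_iff:
  "z \<in> tangent_bundle A \<longleftrightarrow> fst z \<in> carrier_of A \<and> snd z \<in> tangent_space A (fst z)"
  by (cases z) (simp add: tangent_bundle_def)

lemma carrier_tangent_atlas: "carrier_of (tangent_atlas A) = tangent_bundle A"
  by (auto simp: carrier_of_def tangent_atlas_def tangent_chart_def tangent_bundle_def)

lemma tangent_atlasI: "c \<in> A \<Longrightarrow> tangent_chart A c \<in> tangent_atlas A"
  by (simp add: tangent_atlas_def)

lemma tangent_atlasE:
  assumes "C \<in> tangent_atlas A"
  obtains c where "c \<in> A" "C = tangent_chart A c"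
  using assms by (auto simp: tangent_atlas_def)

context smooth_atlas
begin

lemma tangent_chart_point:
  assumes "c \<in> A" "p \<in> fst c"
  shows "(p, coord_vec A c p v) \<in> tangent_bundle A"
    and "snd (tangent_chart A c) (p, coord_vec A c p v) = (snd c p, v)"
  using assms by (auto simp: tangent_bundle_iff tangent_chart_map in_carrier)

lemma tangent_chart_overlap:
  assumes "c \<in> A"
  shows "snd (tangent_chart A c) ` (fst (tangent_chart A c) \<inter> fst (tangent_chart A c')) =
    snd c ` (fst c \<inter> fst c') \<times> UNIV"
proof (intro equalityI subsetI)
  fix y assume "y \<in> snd c ` (fst c \<inter> fst c') \<times> (UNIV :: 'e set)"
  then obtain p v where p: "p \<in> fst c" "p \<in> fst c'" and y: "y = (snd c p, v)" by auto
  show "y \<in> snd (tangent_chart A c) ` (fst (tangent_chart A c) \<inter> fst (tangent_chart A c'))"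
    by (rule image_eqI[of _ _ "(p, coord_vec A c p v)"])
      (use p assms tangent_chart_point[OF assms p(1)] in \<open>auto simp: y tangent_chart_domain\<close>)
qed (auto simp: tangent_chart_domain tangent_chart_map)

lemma tangent_chart_inj:
  assumes "c \<in> A"
  shows "inj_on (snd (tangent_chart A c)) (fst (tangent_chart A c))"
proof (rule inj_onI)
  fix z z'
  assume z: "z \<in> fst (tangent_chart A c)" "z' \<in> fst (tangent_chart A c)"
    and eq: "snd (tangent_chart A c) z = snd (tangent_chart A c) z'"
  have p: "fst z = fst z'"
    using inj_onD[OF chart_inj[OF assms]] z eq by (simp add: tangent_chart_domain tangent_chart_map)
  moreover have "snd z = snd z'"
    using tangent_eqI[OF _ _ assms, of "snd z" "fst z" "snd z'"] z eq p
    by (simp add: tangent_chart_domain tangent_chart_map tangent_bundle_iff)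
  ultimately show "z = z'" by (rule prod_eqI)
qed

lemma tangent_transition:
  assumes "c \<in> A" "c' \<in> A" "p \<in> fst c" "p \<in> fst c'"
  shows "(snd (tangent_chart A c') \<circ> chart_inv (tangent_chart A c)) (snd c p, v) =
    (snd c' p, chart_jacobian c c' p v)"
proof -
  have "chart_inv (tangent_chart A c) (snd c p, v) = (p, coord_vec A c p v)"
    unfolding chart_inv_def
    using inv_into_f_f[OF tangent_chart_inj[OF assms(1)], of "(p, coord_vec A c p v)"]
      tangent_chart_point[OF assms(1,3), of v] assms(3) by (simp add: tangent_chart_domain)
  then show ?thesis using assms by (simp add: tangent_chart_map coord_vec_apply)
qed

text \<open>The transition map of induced charts is \<open>(x, v) \<mapsto> (T x, DT(x) v)\<close>. Its second component is
  smooth jointly in \<open>x\<close> and \<open>v\<close> because it is a finite sum of coordinates of \<open>v\<close> times directional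
  derivatives of \<open>T\<close> at \<open>x\<close> in fixed directions.\<close>

theorem tangent_atlas_smooth: "smooth_atlas (tangent_atlas A)"
proof
  obtain B :: "'e set" where B: "orthonormal_frame B" using frame by blast
  then show "\<exists>C :: ('e \<times> 'e) set. orthonormal_frame C" by (rule orthonormal_frame_product)
  fix C assume "C \<in> tangent_atlas A"
  then obtain c where c: "c \<in> A" "C = tangent_chart A c" by (rule tangent_atlasE)
  show "inj_on (snd C) (fst C)" unfolding c by (rule tangent_chart_inj[OF c(1)])
  fix C' assume "C' \<in> tangent_atlas A"
  then obtain c' where c': "c' \<in> A" "C' = tangent_chart A c'" by (rule tangent_atlasE)
  let ?S = "snd c ` (fst c \<inter> fst c')"
  let ?T = "snd c' \<circ> chart_inv c"
  have S: "open ?S" by (rule overlap_open[OF c(1) c'(1)])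
  have SU: "open (?S \<times> (UNIV :: 'e set))" using S by (simp add: open_Times)
  then show "open (snd C ` (fst C \<inter> fst C'))"
    unfolding c c' tangent_chart_overlap[OF c(1)] .
  have "bounded_linear (\<lambda>z :: 'e \<times> 'e. snd z \<bullet> b)" for b
    using bounded_linear_compose[OF bounded_linear_inner_left bounded_linear_snd] .
  then have "smooth_on (\<lambda>z. (?T (fst z), \<Sum>b\<in>B. (snd z \<bullet> b) *\<^sub>R frechet_derivative ?T (at (fst z)) b))
      (?S \<times> (UNIV :: 'e set))"
    by (intro smooth_on_Pair[OF SU] smooth_on_sum[OF SU] smooth_on_scaleR[OF SU]
        smooth_on_bounded_linear[OF SU] smooth_on_compose_fst[OF S, of ?T]
        smooth_on_compose_fst[OF S, of "\<lambda>x. frechet_derivative ?T (at x) b" for b]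
        smooth_on_frechet transition_smooth c c')
  moreover have "(?T (fst z), \<Sum>b\<in>B. (snd z \<bullet> b) *\<^sub>R frechet_derivative ?T (at (fst z)) b) =
      (snd C' \<circ> chart_inv C) z" if zin: "z \<in> ?S \<times> (UNIV :: 'e set)" for z
  proof -
    obtain p where p: "p \<in> fst c" "p \<in> fst c'" "fst z = snd c p" using zin by auto
    define v where "v = snd z"
    have z: "z = (snd c p, v)" using p(3) by (simp add: v_def prod_eq_iff)
    note p = p(1,2)
    have "(\<Sum>b\<in>B. (v \<bullet> b) *\<^sub>R chart_jacobian c c' p b) = chart_jacobian c c' p v"
      by (rule linear_frame_expansion[OF B chart_jacobian_linear[OF c(1) c'(1) p]])
    moreover have "?T (snd c p) = snd c' p" using c(1) p by simp
    moreover have "(snd C' \<circ> chart_inv C) z = (snd c' p, chart_jacobian c c' p v)"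
      unfolding z c(2) c'(2) by (rule tangent_transition[OF c(1) c'(1) p])
    ultimately show ?thesis by (simp only: z fst_conv snd_conv chart_jacobian_def)
  qed
  ultimately show "smooth_on (snd C' \<circ> chart_inv C) (snd C ` (fst C \<inter> fst C'))"
    unfolding c(2) c'(2) tangent_chart_overlap[OF c(1)] by (rule smooth_on_cong[OF SU, rotated])
qed

end

lemma supported_zero: "supported A 0"
  by (simp add: supported_def)

text \<open>The results on atlases are available here both for \<open>A\<close> and, under the prefix \<open>TM\<close>, for the
  induced atlas; by \<open>tangent_atlas_smooth\<close> every smooth atlas gives an instance.\<close>

locale tangent_setting = smooth_atlas A + TM: smooth_atlas "tangent_atlas A"
  for A :: "('p, 'e::real_inner) atlas"

lemma tangent_settingI: "smooth_atlas A \<Longrightarrow> tangent_setting A"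
  by (simp add: tangent_setting_def smooth_atlas.tangent_atlas_smooth)

text \<open>At the point \<open>z = (p, u)\<close> of the tangent bundle, \<open>snd z\<close> is the tangent vector \<open>u\<close> itself. In
  coordinates the form is \<open>\<Sum>\<^sub>j v\<^sup>j \<iota>(\<partial>/\<partial>x\<^sup>j) \<eta>\<close>.\<close>

definition tautological_contraction ::
    "('p, 'e::real_normed_vector) atlas \<Rightarrow> ('p, 'e) form \<Rightarrow> ('p \<times> ('p, 'e) tvec, 'e \<times> 'e) form"
  where "tautological_contraction A \<eta> z Us =
    (if z \<in> tangent_bundle A \<and> set Us \<subseteq> tangent_space (tangent_atlas A) z
     then \<eta> (fst z) (snd z # map (pushforward (tangent_atlas A) A fst z) Us) else 0)"

context tangent_setting
begin

lemma tangent_chart_image: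
  "c \<in> A \<Longrightarrow> snd (tangent_chart A c) ` fst (tangent_chart A c) = snd c ` fst c \<times> UNIV"
  using tangent_chart_overlap[of c c] by simp

lemma tangent_chart_image_open: "c \<in> A \<Longrightarrow> open (snd c ` fst c \<times> (UNIV :: 'e set))"
  by (simp add: open_Times chart_image_open)

lemma projection_derivative:
  assumes c: "c \<in> A" "c' \<in> A" and z: "z \<in> tangent_bundle A" "fst z \<in> fst c" "fst z \<in> fst c'"
  shows "((snd c' \<circ> fst \<circ> chart_inv (tangent_chart A c)) has_derivative
    (\<lambda>W. chart_jacobian c c' (fst z) (fst W))) (at (snd (tangent_chart A c) z))"
proof -
  have "((\<lambda>y. (snd c' \<circ> chart_inv c) (fst y)) has_derivative
      (\<lambda>W. chart_jacobian c c' (fst z) (fst W))) (at (snd (tangent_chart A c) z))"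
    by (rule has_derivative_compose[OF bounded_linear_imp_has_derivative[OF bounded_linear_fst]])
      (use chart_jacobian_has_derivative[OF c z(2,3)] in \<open>simp add: tangent_chart_map o_def\<close>)
  then show ?thesis
  proof (rule has_derivative_transform_within_open[OF _ TM.overlap_open])
    let ?C = "tangent_chart A c" and ?C' = "tangent_chart A c'"
    show "?C \<in> tangent_atlas A" "?C' \<in> tangent_atlas A" using c by (simp_all add: tangent_atlasI)
    show "snd ?C z \<in> snd ?C ` (fst ?C \<inter> fst ?C')" using z by (auto simp: tangent_chart_domain)
    show "(snd c' \<circ> chart_inv c) (fst y) = (snd c' \<circ> fst \<circ> chart_inv ?C) y"
      if "y \<in> snd ?C ` (fst ?C \<inter> fst ?C')" for y
      using that c TM.chart_inv_chart[OF tangent_atlasI[OF c(1)]]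
      by (auto simp: tangent_chart_domain tangent_chart_map)
  qed
qed

lemma fst_chart_jacobian_tangent:
  assumes c: "c \<in> A" "c' \<in> A" and z: "z \<in> tangent_bundle A" "fst z \<in> fst c" "fst z \<in> fst c'"
  shows "fst (chart_jacobian (tangent_chart A c) (tangent_chart A c') z W) =
    chart_jacobian c c' (fst z) (fst W)"
proof -
  let ?C = "tangent_chart A c" and ?C' = "tangent_chart A c'"
  have "((\<lambda>y. fst ((snd ?C' \<circ> chart_inv ?C) y)) has_derivative
      (\<lambda>W. fst (chart_jacobian ?C ?C' z W))) (at (snd ?C z))"
    by (intro has_derivative_fst TM.chart_jacobian_has_derivative)
      (use c z in \<open>auto simp: tangent_atlasI tangent_chart_domain\<close>)
  moreover have "(\<lambda>y. fst ((snd ?C' \<circ> chart_inv ?C) y)) = snd c' \<circ> fst \<circ> chart_inv ?C"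
    by (auto simp: tangent_chart_map)
  ultimately show ?thesis
    using has_derivative_unique[OF _ projection_derivative[OF c z]] by metis
qed

text \<open>Transition maps are linear on fibres, so on vertical vectors their derivative is again \<open>DT(x)\<close>. This
  is why the mirror map does not depend on the chart.\<close>

lemma chart_jacobian_tangent_vertical:
  assumes c: "c \<in> A" "c' \<in> A" and z: "z \<in> tangent_bundle A" "fst z \<in> fst c" "fst z \<in> fst c'"
  shows "chart_jacobian (tangent_chart A c) (tangent_chart A c') z (0, a) =
    (0, chart_jacobian c c' (fst z) a)"
proof -
  let ?C = "tangent_chart A c" and ?C' = "tangent_chart A c'"
  let ?J = "chart_jacobian c c' (fst z)"
  have D: "((snd ?C' \<circ> chart_inv ?C) has_derivative chart_jacobian ?C ?C' z) (at (snd ?C z))"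
    by (rule TM.chart_jacobian_has_derivative)
      (use c z in \<open>auto simp: tangent_atlasI tangent_chart_domain\<close>)
  have "(snd ?C' \<circ> chart_inv ?C) (snd ?C z + s *\<^sub>R (0, a)) =
      (snd c' (fst z), ?J (snd z c)) + s *\<^sub>R (0, ?J a)" for s
    using tangent_transition[OF c z(2,3), of "snd z c + s *\<^sub>R a"]
      chart_jacobian_linear[OF c z(2,3)]
    by (simp add: tangent_chart_map linear_add linear_scale)
  from derivative_along_line[OF D this] show ?thesis .
qed

text \<open>The definition of the pushforward uses the chart chosen at \<open>z\<close>; in every induced chart it drops the
  vertical component.\<close>

lemma pushforward_projection:
  assumes c: "c \<in> A" and z: "z \<in> tangent_bundle A" "fst z \<in> fst c"
    and U: "U \<in> tangent_space (tangent_atlas A) z"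
  shows "pushforward (tangent_atlas A) A fst z U = coord_vec A c (fst z) (fst (U (tangent_chart A c)))"
proof
  fix c'
  show "pushforward (tangent_atlas A) A fst z U c' =
      coord_vec A c (fst z) (fst (U (tangent_chart A c))) c'"
  proof (cases "c' \<in> charts_at A (fst z)")
    case False
    then show ?thesis by (simp add: pushforward_def coord_vec_eq)
  next
    case True
    then have c': "c' \<in> A" "fst z \<in> fst c'" by (auto simp: charts_at_def)
    have zc: "z \<in> carrier_of (tangent_atlas A)" using z by (simp add: carrier_tangent_atlas)
    obtain c1 where c1: "c1 \<in> A" "chart_at (tangent_atlas A) z = tangent_chart A c1"
      using chart_at_in(1)[OF zc] by (rule tangent_atlasE)
    have z1: "fst z \<in> fst c1"
      using chart_at_in(2)[OF zc] by (simp add: c1 tangent_chart_domain)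
    have "U (tangent_chart A c1) = chart_jacobian (tangent_chart A c) (tangent_chart A c1) z (U (tangent_chart A c))"
      using z z1 by (intro TM.tangent_jacobian U tangent_atlasI c c1) (auto simp: tangent_chart_domain)
    then have "fst (U (tangent_chart A c1)) = chart_jacobian c c1 (fst z) (fst (U (tangent_chart A c)))"
      using fst_chart_jacobian_tangent[OF c c1(1) z z1] by simp
    moreover have "pushforward (tangent_atlas A) A fst z U c' =
        chart_jacobian c1 c' (fst z) (fst (U (tangent_chart A c1)))"
      using True frechet_derivative_eqI[OF projection_derivative[OF c1(1) c'(1) z(1) z1 c'(2)]]
      by (simp add: pushforward_def c1(2) Let_def)
    ultimately show ?thesis
      using chart_jacobian_cocycle[OF c c1(1) c'(1) z(2) z1 c'(2)] c' by (simp add: coord_vec_apply)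
  qed
qed

lemma pushforward_coord_vec:
  assumes c: "c \<in> A" and z: "z \<in> tangent_bundle A" "fst z \<in> fst c"
  shows "pushforward (tangent_atlas A) A fst z (coord_vec (tangent_atlas A) (tangent_chart A c) z W) =
    coord_vec A c (fst z) (fst W)"
proof -
  have C: "tangent_chart A c \<in> tangent_atlas A" "z \<in> fst (tangent_chart A c)"
    using c z by (auto simp: tangent_atlasI tangent_chart_domain)
  show ?thesis
    using pushforward_projection[OF c z TM.coord_vec_tangent[OF C]] TM.coord_vec_self[OF C] by simp
qed

lemma mirror_map_coord_vec:
  assumes c: "c \<in> A" and z: "z \<in> tangent_bundle A" "fst z \<in> fst c"
  shows "mirror_map A z (coord_vec (tangent_atlas A) (tangent_chart A c) z W) =
    coord_vec (tangent_atlas A) (tangent_chart A c) z (0, fst W)"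
proof
  fix C'
  show "mirror_map A z (coord_vec (tangent_atlas A) (tangent_chart A c) z W) C' =
    coord_vec (tangent_atlas A) (tangent_chart A c) z (0, fst W) C'"
  proof (cases "C' \<in> charts_at (tangent_atlas A) z")
    case False
    then show ?thesis by (simp add: mirror_map_def TM.coord_vec_eq)
  next
    case True
    then have C': "C' \<in> tangent_atlas A" "z \<in> fst C'" by (auto simp: charts_at_def)
    obtain c' where c': "c' \<in> A" "C' = tangent_chart A c'" using C'(1) by (rule tangent_atlasE)
    have z': "fst z \<in> fst c'" using C'(2) by (simp add: c' tangent_chart_domain)
    show ?thesis
      using True fst_chart_jacobian_tangent[OF c c'(1) z z'] chart_jacobian_tangent_vertical[OF c c'(1) z z']
      by (simp add: mirror_map_def TM.coord_vec_eq c'(2))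
  qed
qed

section \<open>Local expressions of forms on the tangent bundle\<close>

lemma local_rep_pullback:
  assumes c: "c \<in> A" "p \<in> fst c"
  shows "local_rep (tangent_atlas A) (tangent_chart A c) (pullback (tangent_atlas A) A fst \<eta>) ws
      (snd c p, v) = local_rep A c \<eta> (map fst ws) (snd c p)"
proof -
  define z where "z = (p, coord_vec A c p v)"
  have z: "z \<in> tangent_bundle A" "snd (tangent_chart A c) z = (snd c p, v)" "fst z = p"
    using tangent_chart_point[OF c] by (simp_all add: z_def)
  have C: "tangent_chart A c \<in> tangent_atlas A" "z \<in> fst (tangent_chart A c)"
    using c z by (auto simp: tangent_atlasI tangent_chart_domain)
  have "set (map (coord_vec (tangent_atlas A) (tangent_chart A c) z) ws) \<subseteq>
      tangent_space (tangent_atlas A) z"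
    using C by auto
  then show ?thesis
    using c z pushforward_coord_vec[OF c(1) z(1)]
    by (simp add: TM.local_rep_at[OF C, unfolded z(2)] local_rep_at[OF c] pullback_def
        carrier_tangent_atlas comp_def)
qed

lemma local_rep_tautological:
  assumes c: "c \<in> A" "p \<in> fst c"
  shows "local_rep (tangent_atlas A) (tangent_chart A c) (tautological_contraction A \<eta>) ws
      (snd c p, v) = local_rep A c \<eta> (v # map fst ws) (snd c p)"
proof -
  define z where "z = (p, coord_vec A c p v)"
  have z: "z \<in> tangent_bundle A" "snd (tangent_chart A c) z = (snd c p, v)" "fst z = p"
    "snd z = coord_vec A c p v"
    using tangent_chart_point[OF c] by (simp_all add: z_def)
  have C: "tangent_chart A c \<in> tangent_atlas A" "z \<in> fst (tangent_chart A c)"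
    using c z by (auto simp: tangent_atlasI tangent_chart_domain)
  have "set (map (coord_vec (tangent_atlas A) (tangent_chart A c) z) ws) \<subseteq>
      tangent_space (tangent_atlas A) z"
    using C by auto
  then show ?thesis
    using c z pushforward_coord_vec[OF c(1) z(1)]
    by (simp add: TM.local_rep_at[OF C, unfolded z(2)] local_rep_at[OF c] tautological_contraction_def
        comp_def)
qed

lemma local_rep_i_B:
  assumes c: "c \<in> A" "p \<in> fst c"
  shows "local_rep (tangent_atlas A) (tangent_chart A c) (i_B A \<omega>) ws (snd c p, v) =
    (\<Sum>k<length ws. local_rep (tangent_atlas A) (tangent_chart A c) \<omega>
      (ws[k := (0, fst (ws ! k))]) (snd c p, v))"
proof -
  define z where "z = (p, coord_vec A c p v)"
  have z: "z \<in> tangent_bundle A" "snd (tangent_chart A c) z = (snd c p, v)" "fst z = p"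
    using tangent_chart_point[OF c] by (simp_all add: z_def)
  have C: "tangent_chart A c \<in> tangent_atlas A" "z \<in> fst (tangent_chart A c)"
    using c z by (auto simp: tangent_atlasI tangent_chart_domain)
  have "set (map (coord_vec (tangent_atlas A) (tangent_chart A c) z) ws) \<subseteq>
      tangent_space (tangent_atlas A) z"
    using C by auto
  then show ?thesis
    using c z mirror_map_coord_vec[OF c(1) z(1)]
    by (simp add: TM.local_rep_at[OF C, unfolded z(2)] i_B_def map_update)
qed

lemma supported_pullback: "supported (tangent_atlas A) (pullback (tangent_atlas A) A fst \<eta>)"
  by (auto simp: supported_def pullback_def)

lemma supported_tautological: "supported (tangent_atlas A) (tautological_contraction A \<eta>)"
  by (auto simp: supported_def tautological_contraction_def carrier_tangent_atlas)

lemma supported_i_B: "supported (tangent_atlas A) (i_B A \<omega>)"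
  by (auto simp: supported_def i_B_def carrier_tangent_atlas)

lemma tangent_form_eqI:
  assumes "supported (tangent_atlas A) \<omega>" "supported (tangent_atlas A) \<omega>'"
    and "\<And>c p v ws. c \<in> A \<Longrightarrow> p \<in> fst c \<Longrightarrow>
      local_rep (tangent_atlas A) (tangent_chart A c) \<omega> ws (snd c p, v) =
      local_rep (tangent_atlas A) (tangent_chart A c) \<omega>' ws (snd c p, v)"
  shows "\<omega> = \<omega>'"
proof (rule TM.form_eqI[OF assms(1,2)])
  fix C z ws assume C: "C \<in> tangent_atlas A" "z \<in> fst C"
  obtain c where c: "c \<in> A" "C = tangent_chart A c" using C(1) by (rule tangent_atlasE)
  show "local_rep (tangent_atlas A) C \<omega> ws (snd C z) = local_rep (tangent_atlas A) C \<omega>' ws (snd C z)"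
    using C(2) assms(3)[OF c(1)] by (simp add: c(2) tangent_chart_domain tangent_chart_map)
qed

lemma tangent_formsI:
  assumes "supported (tangent_atlas A) \<omega>" "\<And>z Us. length Us \<noteq> q \<Longrightarrow> \<omega> z Us = 0"
    and "\<And>c p v. c \<in> A \<Longrightarrow> p \<in> fst c \<Longrightarrow>
      alternating q (\<lambda>ws. local_rep (tangent_atlas A) (tangent_chart A c) \<omega> ws (snd c p, v))"
    and "\<And>c ws. c \<in> A \<Longrightarrow> length ws = q \<Longrightarrow>
      smooth_on (local_rep (tangent_atlas A) (tangent_chart A c) \<omega> ws) (snd c ` fst c \<times> UNIV)"
  shows "\<omega> \<in> forms (tangent_atlas A) q"
proof (rule TM.formsI[OF assms(1,2)])
  fix C z assume C: "C \<in> tangent_atlas A" "z \<in> fst C"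
  obtain c where c: "c \<in> A" "C = tangent_chart A c" using C(1) by (rule tangent_atlasE)
  show "alternating q (\<lambda>ws. local_rep (tangent_atlas A) C \<omega> ws (snd C z))"
    using C(2) assms(3)[OF c(1)] by (simp add: c(2) tangent_chart_domain tangent_chart_map)
next
  fix C and ws :: "('e \<times> 'e) list" assume C: "C \<in> tangent_atlas A" and l: "length ws = q"
  obtain c where c: "c \<in> A" "C = tangent_chart A c" using C(1) by (rule tangent_atlasE)
  show "smooth_on (local_rep (tangent_atlas A) C \<omega> ws) (snd C ` fst C)"
    using assms(4)[OF c(1) l] by (simp add: c(2) tangent_chart_image[OF c(1)])
qed

lemma pullback_forms:
  assumes \<eta>: "\<eta> \<in> forms A q"
  shows "pullback (tangent_atlas A) A fst \<eta> \<in> forms (tangent_atlas A) q"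
proof (rule tangent_formsI[OF supported_pullback])
  show "pullback (tangent_atlas A) A fst \<eta> z Us = 0" if "length Us \<noteq> q" for z Us
    using that by (simp add: pullback_def forms_length[OF \<eta>])
next
  fix c p v assume c: "c \<in> A" "p \<in> fst c"
  have "alternating q (\<lambda>ws. local_rep A c \<eta> ws (snd c p))"
    using c by (intro forms_alternating[OF \<eta>]) auto
  from alternating_map[OF this linear_fst]
  show "alternating q (\<lambda>ws. local_rep (tangent_atlas A) (tangent_chart A c)
      (pullback (tangent_atlas A) A fst \<eta>) ws (snd c p, v))"
    by (simp only: local_rep_pullback[OF c])
next
  fix c and ws :: "('e \<times> 'e) list" assume c: "c \<in> A"
  show "smooth_on (local_rep (tangent_atlas A) (tangent_chart A c)
      (pullback (tangent_atlas A) A fst \<eta>) ws) (snd c ` fst c \<times> UNIV)"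
    by (rule smooth_on_cong[OF tangent_chart_image_open[OF c] _
          smooth_on_compose_fst[OF chart_image_open[OF c] forms_smooth[OF \<eta> c]]])
      (auto simp: local_rep_pullback[OF c])
qed

lemma tautological_forms:
  assumes \<eta>: "\<eta> \<in> forms A (Suc r)"
  shows "tautological_contraction A \<eta> \<in> forms (tangent_atlas A) r"
proof (rule tangent_formsI[OF supported_tautological])
  show "tautological_contraction A \<eta> z Us = 0" if "length Us \<noteq> r" for z Us
    using that by (simp add: tautological_contraction_def forms_length[OF \<eta>])
next
  fix c p v assume c: "c \<in> A" "p \<in> fst c"
  have "alternating (Suc r) (\<lambda>ws. local_rep A c \<eta> ws (snd c p))"
    using c by (intro forms_alternating[OF \<eta>]) auto
  from alternating_map[OF alternating_Cons[OF this] linear_fst]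
  show "alternating r (\<lambda>ws. local_rep (tangent_atlas A) (tangent_chart A c)
      (tautological_contraction A \<eta>) ws (snd c p, v))"
    by (simp only: local_rep_tautological[OF c])
next
  fix c and ws :: "('e \<times> 'e) list" assume c: "c \<in> A" and l: "length ws = r"
  obtain B :: "'e set" where B: "orthonormal_frame B" using frame by blast
  note SU = tangent_chart_image_open[OF c]
  have "bounded_linear (\<lambda>z :: 'e \<times> 'e. snd z \<bullet> b)" for b
    using bounded_linear_compose[OF bounded_linear_inner_left bounded_linear_snd] .
  then have "smooth_on (\<lambda>z. \<Sum>b\<in>B. (snd z \<bullet> b) * local_rep A c \<eta> (b # map fst ws) (fst z))
      (snd c ` fst c \<times> UNIV)"
    by (intro smooth_on_sum[OF SU] smooth_on_mult[OF SU] smooth_on_bounded_linear[OF SU]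
        smooth_on_compose_fst[OF chart_image_open[OF c] forms_smooth[OF \<eta> c]])
  moreover have "(\<Sum>b\<in>B. (snd z \<bullet> b) * local_rep A c \<eta> (b # map fst ws) (fst z)) =
      local_rep (tangent_atlas A) (tangent_chart A c) (tautological_contraction A \<eta>) ws z"
    if zin: "z \<in> snd c ` fst c \<times> UNIV" for z
  proof -
    obtain p where p: "p \<in> fst c" "fst z = snd c p" using zin by auto
    define v where "v = snd z"
    have z: "z = (snd c p, v)" using p(2) by (simp add: v_def prod_eq_iff)
    note p = p(1)
    have "multilinear (Suc r) (\<lambda>ws. local_rep A c \<eta> ws (snd c p))"
      using forms_alternating[OF \<eta> c, of "snd c p"] p by (simp add: alternating_def)
    from multilinear_linear[OF this, of "[]" "map fst ws"]
    have "linear (\<lambda>w. local_rep A c \<eta> (w # map fst ws) (snd c p))" using l by simp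
    from linear_frame_expansion[OF B this, of v] show ?thesis
      using local_rep_tautological[OF c p] by (simp add: z)
  qed
  ultimately show "smooth_on (local_rep (tangent_atlas A) (tangent_chart A c)
      (tautological_contraction A \<eta>) ws) (snd c ` fst c \<times> UNIV)"
    by (rule smooth_on_cong[OF SU, rotated])
qed

lemma linear_mirror: "linear (\<lambda>w :: 'e \<times> 'e. (0 :: 'e, fst w))"
  by (rule linearI) auto

lemma i_B_forms:
  assumes \<omega>: "\<omega> \<in> forms (tangent_atlas A) q"
  shows "i_B A \<omega> \<in> forms (tangent_atlas A) q"
proof (rule tangent_formsI[OF supported_i_B])
  show "i_B A \<omega> z Us = 0" if "length Us \<noteq> q" for z Us
    using that by (simp add: i_B_def TM.forms_length[OF \<omega>])
next
  fix c p v assume c: "c \<in> A" "p \<in> fst c"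
  have "alternating q (\<lambda>ws. local_rep (tangent_atlas A) (tangent_chart A c) \<omega> ws (snd c p, v))"
    using c by (intro TM.forms_alternating[OF \<omega>]) (auto simp: tangent_atlasI tangent_chart_image)
  from alternating_derivation[OF this linear_mirror]
  show "alternating q (\<lambda>ws. local_rep (tangent_atlas A) (tangent_chart A c) (i_B A \<omega>) ws (snd c p, v))"
    by (simp only: local_rep_i_B[OF c])
next
  fix c and ws :: "('e \<times> 'e) list" assume c: "c \<in> A"
  note SU = tangent_chart_image_open[OF c]
  have "smooth_on (\<lambda>z. \<Sum>k<length ws. local_rep (tangent_atlas A) (tangent_chart A c) \<omega>
      (ws[k := (0, fst (ws ! k))]) z) (snd c ` fst c \<times> UNIV)"
    using TM.forms_smooth[OF \<omega> tangent_atlasI[OF c]]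
    by (intro smooth_on_sum[OF SU]) (simp add: tangent_chart_image[OF c])
  then show "smooth_on (local_rep (tangent_atlas A) (tangent_chart A c) (i_B A \<omega>) ws)
      (snd c ` fst c \<times> UNIV)"
    by (rule smooth_on_cong[OF SU, rotated]) (auto simp: local_rep_i_B[OF c])
qed

lemma i_B_differentiable:
  assumes \<omega>: "differentiable_form (tangent_atlas A) \<omega>"
  shows "differentiable_form (tangent_atlas A) (i_B A \<omega>)"
  unfolding differentiable_form_def
proof (intro ballI allI)
  fix C ws y assume C: "C \<in> tangent_atlas A" and y: "y \<in> snd C ` fst C"
  obtain c where c: "c \<in> A" "C = tangent_chart A c" using C(1) by (rule tangent_atlasE)
  have y': "y \<in> snd c ` fst c \<times> UNIV" using y by (simp add: c tangent_chart_image)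
  have "local_rep (tangent_atlas A) C \<omega> us differentiable (at y)" for us
    using \<omega> C y unfolding differentiable_form_def by blast
  then have "(\<lambda>z. \<Sum>k<length ws. local_rep (tangent_atlas A) C \<omega> (ws[k := (0, fst (ws ! k))]) z)
      differentiable (at y)"
    by (intro differentiable_sum) auto
  then obtain D where "((\<lambda>z. \<Sum>k<length ws. local_rep (tangent_atlas A) C \<omega>
      (ws[k := (0, fst (ws ! k))]) z) has_derivative D) (at y)"
    unfolding differentiable_def by blast
  then have "(local_rep (tangent_atlas A) C (i_B A \<omega>) ws has_derivative D) (at y)"
    by (rule has_derivative_transform_within_open[OF _ tangent_chart_image_open[OF c(1)] y'])
      (auto simp: c(2) local_rep_i_B[OF c(1)])
  then show "local_rep (tangent_atlas A) C (i_B A \<omega>) ws differentiable (at y)"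
    unfolding differentiable_def by blast
qed

section \<open>The operators d and i_B on pulled back and contracted forms\<close>

lemma ext_deriv_pullback:
  assumes \<eta>: "\<eta> \<in> forms A q"
  shows "ext_deriv (tangent_atlas A) (pullback (tangent_atlas A) A fst \<eta>) =
    pullback (tangent_atlas A) A fst (ext_deriv A \<eta>)"
proof (rule tangent_form_eqI[OF supported_ext_deriv supported_pullback])
  fix c p v and ws :: "('e \<times> 'e) list"
  assume c: "c \<in> A" "p \<in> fst c"
  let ?TA = "tangent_atlas A" and ?C = "tangent_chart A c"
  let ?P = "pullback ?TA A fst \<eta>"
  define z where "z = (p, coord_vec A c p v)"
  have z: "z \<in> fst ?C" "snd ?C z = (snd c p, v)"
    using tangent_chart_point[OF c] c by (auto simp: z_def tangent_chart_domain)
  have "local_rep ?TA ?C (ext_deriv ?TA ?P) ws (snd c p, v) = local_d (local_rep ?TA ?C ?P) ws (snd c p, v)"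
    using TM.local_rep_ext_deriv[OF pullback_forms[OF \<eta>] tangent_atlasI[OF c(1)] z(1)] by (simp add: z(2))
  also have "\<dots> = local_d (local_rep A c \<eta>) (map fst ws) (snd c p)"
  proof (cases "length ws = Suc q")
    case False
    then show ?thesis
      by (simp add: local_d_length[OF \<eta>] TM.local_d_length[OF pullback_forms[OF \<eta>]])
  next
    case True
    obtain B :: "'e set" where B: "orthonormal_frame B" using frame by blast
    have f: "frechet_derivative fst (at y) = fst" for y :: "'e \<times> 'e"
      by (rule frechet_derivative_eqI[OF bounded_linear_imp_has_derivative[OF bounded_linear_fst]])
    note SU = tangent_chart_image_open[OF c(1)]
    have "local_d (local_rep ?TA ?C ?P) ws (snd c p, v) =
        local_d (local_rep A c \<eta>) (map (frechet_derivative fst (at (snd c p, v))) ws) (fst (snd c p, v))"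
    proof (rule local_d_pullback[OF B SU _ chart_image_open[OF c(1)] _
          smooth_on_bounded_linear[OF SU bounded_linear_fst] forms_alternating[OF \<eta> c(1)] _ _ True])
      show "(snd c p, v) \<in> snd c ` fst c \<times> UNIV" using c by blast
      show "local_rep A c \<eta> ws differentiable (at (fst (snd c p, v)))" for ws
        using smooth_on_differentiable[OF forms_smooth[OF \<eta> c(1)]] c by simp
      show "local_rep ?TA ?C ?P ws y = local_rep A c \<eta> (map (frechet_derivative fst (at y)) ws) (fst y)"
        if "y \<in> snd c ` fst c \<times> UNIV" for ws y
        using that by (auto simp: f local_rep_pullback[OF c(1)])
    qed auto
    then show ?thesis by (simp add: f)
  qed
  also have "\<dots> = local_rep A c (ext_deriv A \<eta>) (map fst ws) (snd c p)"
    by (rule local_rep_ext_deriv[OF \<eta> c, symmetric])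
  also have "\<dots> = local_rep ?TA ?C (pullback ?TA A fst (ext_deriv A \<eta>)) ws (snd c p, v)"
    by (rule local_rep_pullback[OF c, symmetric])
  finally show "local_rep ?TA ?C (ext_deriv ?TA ?P) ws (snd c p, v) = \<dots>" .
qed

lemma local_rep_zero_vector:
  assumes "\<eta> \<in> forms A q" "c \<in> A" "p \<in> fst c" "0 \<in> set ws"
  shows "local_rep A c \<eta> ws (snd c p) = 0"
proof (cases "length ws = q")
  case True
  have "multilinear q (\<lambda>ws. local_rep A c \<eta> ws (snd c p))"
    using forms_alternating[OF assms(1,2), of "snd c p"] assms(3) by (simp add: alternating_def)
  from multilinear_zero[OF this True assms(4)] show ?thesis .
next
  case False
  then show ?thesis by (simp add: local_rep_length[OF assms(1)])
qed

lemma zero_in_map_fst_update: "k < length ws \<Longrightarrow> 0 \<in> set (map fst (ws[k := (0, a)]))"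
  by (metis fst_conv length_map map_update set_update_memI)

text \<open>The mirror map makes a vector vertical, so every summand of \<open>i_B\<close> has an argument that projects to
  zero. The same reason applies to the tautological contraction.\<close>

lemma i_B_pullback:
  assumes \<eta>: "\<eta> \<in> forms A q"
  shows "i_B A (pullback (tangent_atlas A) A fst \<eta>) = 0"
proof (rule tangent_form_eqI[OF supported_i_B supported_zero])
  fix c p v and ws :: "('e \<times> 'e) list"
  assume c: "c \<in> A" "p \<in> fst c"
  show "local_rep (tangent_atlas A) (tangent_chart A c) (i_B A (pullback (tangent_atlas A) A fst \<eta>)) ws (snd c p, v) =
    local_rep (tangent_atlas A) (tangent_chart A c) 0 ws (snd c p, v)"
    using local_rep_zero_vector[OF \<eta> c] zero_in_map_fst_update[of _ ws]
    by (simp add: local_rep_i_B[OF c] local_rep_pullback[OF c] TM.local_rep_zero)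
qed

lemma i_B_tautological:
  assumes \<eta>: "\<eta> \<in> forms A q"
  shows "i_B A (tautological_contraction A \<eta>) = 0"
proof (rule tangent_form_eqI[OF supported_i_B supported_zero])
  fix c p v and ws :: "('e \<times> 'e) list"
  assume c: "c \<in> A" "p \<in> fst c"
  show "local_rep (tangent_atlas A) (tangent_chart A c) (i_B A (tautological_contraction A \<eta>)) ws (snd c p, v) =
    local_rep (tangent_atlas A) (tangent_chart A c) 0 ws (snd c p, v)"
    using local_rep_zero_vector[OF \<eta> c] zero_in_map_fst_update[of _ ws]
    by (simp add: local_rep_i_B[OF c] local_rep_tautological[OF c] TM.local_rep_zero)
qed

text \<open>Along a fibre the local expression \<open>v \<mapsto> \<eta>(v, \<dots>)\<close> is linear, hence its own derivative.\<close>

lemma tautological_vertical_derivative: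
  assumes \<eta>: "\<eta> \<in> forms A (Suc r)" and c: "c \<in> A" "p \<in> fst c" and len: "length us = r"
  shows "frechet_derivative (local_rep (tangent_atlas A) (tangent_chart A c)
      (tautological_contraction A \<eta>) us) (at (snd c p, v)) (0, a) =
    local_rep A c \<eta> (a # map fst us) (snd c p)"
proof -
  let ?TA = "tangent_atlas A" and ?C = "tangent_chart A c"
  let ?R = "local_rep ?TA ?C (tautological_contraction A \<eta>) us"
  have D: "(?R has_derivative frechet_derivative ?R (at (snd c p, v))) (at (snd c p, v))"
    using TM.forms_smooth[OF tautological_forms[OF \<eta>] tangent_atlasI[OF c(1)]] c
    by (intro smooth_on_derivative) (auto simp: tangent_chart_image)
  have "multilinear (Suc r) (\<lambda>ws. local_rep A c \<eta> ws (snd c p))"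
    using forms_alternating[OF \<eta> c(1), of "snd c p"] c by (simp add: alternating_def)
  from multilinear_linear[OF this, of "[]" "map fst us"] len
  have L: "linear (\<lambda>w. local_rep A c \<eta> (w # map fst us) (snd c p))" by simp
  have "?R ((snd c p, v) + s *\<^sub>R (0, a)) = local_rep A c \<eta> (v # map fst us) (snd c p) +
      s *\<^sub>R local_rep A c \<eta> (a # map fst us) (snd c p)" for s
    using linear_add[OF L, of v "s *\<^sub>R a"] linear_scale[OF L, of s a]
    by (simp add: local_rep_tautological[OF c])
  from derivative_along_line[OF D this] show ?thesis .
qed

text \<open>One summand of \<open>i_B d\<tau>\<close>, in which the vector in slot \<open>k\<close> is made vertical. In the coordinate formula
  for \<open>d\<tau>\<close> every term that keeps this vector as an argument vanishes, so only the derivative in its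
  direction is left. That derivative inserts the horizontal part of the vector as the first argument of
  \<open>\<eta>\<close>, and moving it back to slot \<open>k\<close> cancels the sign.\<close>

lemma local_d_tautological_vertical:
  assumes \<eta>: "\<eta> \<in> forms A (Suc r)" and c: "c \<in> A" "p \<in> fst c"
    and len: "length ws = Suc r" and k: "k < Suc r"
  shows "local_d (local_rep (tangent_atlas A) (tangent_chart A c) (tautological_contraction A \<eta>))
      (ws[k := (0, fst (ws ! k))]) (snd c p, v) = local_rep A c \<eta> (map fst ws) (snd c p)"
proof -
  let ?R = "local_rep (tangent_atlas A) (tangent_chart A c) (tautological_contraction A \<eta>)"
  define us where "us = ws[k := (0, fst (ws ! k))]"
  let ?F = "\<lambda>ws. local_rep A c \<eta> ws (snd c p)"
  have lu: "length us = Suc r" using len by (simp add: us_def)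
  have alt: "alternating (Suc r) ?F"
    using c by (intro forms_alternating[OF \<eta>]) auto
  have "(-1) ^ i * frechet_derivative (?R (drop_nth i us)) (at (snd c p, v)) (us ! i) =
      (if i = k then ?F (map fst ws) else 0)" if i: "i < Suc r" for i
  proof (cases "i = k")
    case False
    have "us ! k \<in> set (drop_nth i us)"
      using k lu False by (intro nth_in_drop_nth) auto
    moreover have "fst (us ! k) = 0" using k len by (simp add: us_def)
    ultimately have "0 \<in> set (w # map fst (drop_nth i us))" for w by force
    then have "0 = ?R (drop_nth i us) y" if "y \<in> snd c ` fst c \<times> UNIV" for y
      using that local_rep_zero_vector[OF \<eta> c(1)] by (auto simp: local_rep_tautological[OF c(1)])
    moreover have "(snd c p, v) \<in> snd c ` fst c \<times> UNIV" using c(2) by simp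
    ultimately have "(?R (drop_nth i us) has_derivative (\<lambda>_. 0)) (at (snd c p, v))"
      using has_derivative_transform_within_open[OF has_derivative_const
          tangent_chart_image_open[OF c(1)]] by metis
    from frechet_derivative_eqI[OF this] False show ?thesis by simp
  next
    case True
    have dk: "drop_nth k us = drop_nth k ws" using k by (simp add: us_def drop_nth_def)
    have uk: "us ! k = (0, fst (ws ! k))" using k len by (simp add: us_def)
    have ld: "length (drop_nth k ws) = r" using len k by (simp add: length_drop_nth)
    have "?F (fst (ws ! k) # map fst (drop_nth k ws)) = (-1) ^ k * ?F (map fst ws)"
      using alternating_move[OF alt, of "[]" "take k (map fst ws)" "drop (Suc k) (map fst ws)" "fst (ws ! k)"]
        id_take_nth_drop[of k "map fst ws"] len k
      by (simp add: drop_nth_def take_map drop_map min_def)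
    then show ?thesis
      using tautological_vertical_derivative[OF \<eta> c ld, of v "fst (ws ! k)"] True
      by (simp add: dk uk)
  qed
  then have "local_d ?R us (snd c p, v) = (\<Sum>i<Suc r. if i = k then ?F (map fst ws) else 0)"
    unfolding local_d_def lu by (intro sum.cong) auto
  then show ?thesis using k by (simp add: us_def)
qed

text \<open>All \<open>r + 1\<close> summands of \<open>i_B\<close> agree.\<close>

lemma i_B_ext_deriv_tautological:
  assumes \<eta>: "\<eta> \<in> forms A (Suc r)"
  shows "i_B A (ext_deriv (tangent_atlas A) (tautological_contraction A \<eta>)) =
    lincomb (real (Suc r)) 0 (pullback (tangent_atlas A) A fst \<eta>) 0"
proof (rule tangent_form_eqI[OF supported_i_B supported_lincomb[OF supported_pullback supported_zero]])
  fix c p v and ws :: "('e \<times> 'e) list"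
  assume c: "c \<in> A" "p \<in> fst c"
  let ?TA = "tangent_atlas A" and ?C = "tangent_chart A c"
  let ?\<tau> = "tautological_contraction A \<eta>"
  define z where "z = (p, coord_vec A c p v)"
  have z: "z \<in> fst ?C" "snd ?C z = (snd c p, v)"
    using tangent_chart_point[OF c] c by (auto simp: z_def tangent_chart_domain)
  have d: "local_rep ?TA ?C (ext_deriv ?TA ?\<tau>) us (snd c p, v) = local_d (local_rep ?TA ?C ?\<tau>) us (snd c p, v)"
    for us
    using TM.local_rep_ext_deriv[OF tautological_forms[OF \<eta>] tangent_atlasI[OF c(1)] z(1)] by (simp add: z(2))
  have "local_rep ?TA ?C (i_B A (ext_deriv ?TA ?\<tau>)) ws (snd c p, v) =
      real (Suc r) * local_rep A c \<eta> (map fst ws) (snd c p)"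
  proof (cases "length ws = Suc r")
    case True
    then show ?thesis
      using local_d_tautological_vertical[OF \<eta> c True]
      by (simp add: local_rep_i_B[OF c] d del: sum.lessThan_Suc)
  next
    case False
    then show ?thesis
      by (simp add: local_rep_i_B[OF c] d TM.local_d_length[OF tautological_forms[OF \<eta>]]
          local_rep_length[OF \<eta>])
  qed
  then show "local_rep ?TA ?C (i_B A (ext_deriv ?TA ?\<tau>)) ws (snd c p, v) =
      local_rep ?TA ?C (lincomb (real (Suc r)) 0 (pullback ?TA A fst \<eta>) 0) ws (snd c p, v)"
    by (simp add: local_rep_lincomb local_rep_pullback[OF c])
qed

section \<open>The induced map on cohomology\<close>

lemma d_B_tautological:
  assumes "\<eta> \<in> forms A (Suc r)"
  shows "d_B A (tautological_contraction A \<eta>) =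
    lincomb (real (Suc r)) 0 (pullback (tangent_atlas A) A fst \<eta>) 0"
  by (simp add: d_B_def i_B_tautological[OF assms] i_B_ext_deriv_tautological[OF assms] TM.ext_deriv_zero)

lemma d_B_pullback:
  assumes "\<omega> \<in> closed_forms A q"
  shows "d_B A (pullback (tangent_atlas A) A fst \<omega>) = 0"
proof -
  have \<omega>: "\<omega> \<in> forms A q" "ext_deriv A \<omega> = 0" using assms by (auto simp: closed_forms_def)
  have "pullback (tangent_atlas A) A fst (0 :: ('p, 'e) form) = 0"
    by (intro ext) (simp add: pullback_def)
  moreover have "i_B A 0 = 0" by (intro ext) (simp add: i_B_def)
  ultimately show ?thesis
    by (simp add: d_B_def ext_deriv_pullback[OF \<omega>(1)] \<omega>(2) i_B_pullback[OF \<omega>(1)] TM.ext_deriv_zero)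
qed

lemma pullback_closed:
  assumes "\<omega> \<in> closed_forms A q"
  shows "pullback (tangent_atlas A) A fst \<omega> \<in> ddB_closed_forms A q"
proof -
  have \<omega>: "\<omega> \<in> forms A q" "ext_deriv A \<omega> = 0" using assms by (auto simp: closed_forms_def)
  have "pullback (tangent_atlas A) A fst (0 :: ('p, 'e) form) = 0"
    by (intro ext) (simp add: pullback_def)
  then show ?thesis
    using \<omega> pullback_forms[OF \<omega>(1)] ext_deriv_pullback[OF \<omega>(1)] d_B_pullback[OF assms]
    by (simp add: ddB_closed_forms_def)
qed

lemma i_B_lincomb: "i_B A (lincomb a b \<omega> \<omega>') = lincomb a b (i_B A \<omega>) (i_B A \<omega>')"
  by (intro ext) (simp add: i_B_def lincomb_def sum.distrib sum_distrib_left)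

lemma d_B_lincomb:
  assumes "\<tau> \<in> forms (tangent_atlas A) q" "\<tau>' \<in> forms (tangent_atlas A) q"
  shows "d_B A (lincomb a b \<tau> \<tau>') = lincomb a b (d_B A \<tau>) (d_B A \<tau>')"
proof -
  have "d_B A (lincomb a b \<tau> \<tau>') =
      lincomb a b (i_B A (ext_deriv (tangent_atlas A) \<tau>)) (i_B A (ext_deriv (tangent_atlas A) \<tau>')) -
      lincomb a b (ext_deriv (tangent_atlas A) (i_B A \<tau>)) (ext_deriv (tangent_atlas A) (i_B A \<tau>'))"
    using assms
    by (simp add: d_B_def i_B_lincomb ext_deriv_lincomb TM.forms_differentiable[of _ q] i_B_forms)
  also have "\<dots> = lincomb a b (d_B A \<tau>) (d_B A \<tau>')"
    by (intro ext) (simp add: lincomb_def d_B_def algebra_simps)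
  finally show ?thesis .
qed

text \<open>This rests on chart independence: only with a fixed chart for \<open>d\<tau>\<close> on a neighbourhood can \<open>d\<^sub>B \<tau>\<close> be
  differentiated. It is the one analytic ingredient of the linearity of \<open>d d\<^sub>B\<close>.\<close>

lemma d_B_differentiable:
  assumes "\<tau> \<in> forms (tangent_atlas A) q"
  shows "differentiable_form (tangent_atlas A) (d_B A \<tau>)"
proof -
  have "d_B A \<tau> = lincomb 1 (-1) (i_B A (ext_deriv (tangent_atlas A) \<tau>))
      (ext_deriv (tangent_atlas A) (i_B A \<tau>))"
    by (intro ext) (simp add: lincomb_def d_B_def)
  then show ?thesis
    using differentiable_form_lincomb i_B_differentiable TM.ext_deriv_differentiable i_B_forms assms
    by metis
qed

lemma ddB_exact_lincomb:
  assumes "\<alpha> \<in> ddB_exact_forms A q" "\<beta> \<in> ddB_exact_forms A q"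
  shows "lincomb a b \<alpha> \<beta> \<in> ddB_exact_forms A q"
proof -
  obtain \<sigma> \<tau> where s: "\<sigma> \<in> forms (tangent_atlas A) (q - 2)" "\<tau> \<in> forms (tangent_atlas A) (q - 2)"
    and \<alpha>: "\<alpha> = ext_deriv (tangent_atlas A) (d_B A \<sigma>)"
    and \<beta>: "\<beta> = ext_deriv (tangent_atlas A) (d_B A \<tau>)"
    using assms by (auto simp: ddB_exact_forms_def)
  have "lincomb a b \<alpha> \<beta> = ext_deriv (tangent_atlas A) (d_B A (lincomb a b \<sigma> \<tau>))"
    using s by (simp add: \<alpha> \<beta> d_B_lincomb ext_deriv_lincomb d_B_differentiable)
  then show ?thesis
    unfolding ddB_exact_forms_def using TM.lincomb_forms[OF s] by blast
qed

text \<open>Dividing \<open>d\<^sub>B \<tau> = (r + 1) P\<eta>\<close> by \<open>r + 1\<close> and applying \<open>d\<close> exhibits the potential; the degree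
  \<open>q - 2\<close> of \<open>\<tau>\<close> is the one demanded by \<open>d d\<^sub>B\<close>-exactness.\<close>

lemma pullback_exact:
  assumes \<eta>: "\<eta> \<in> forms A (q - 1)" and q: "q \<ge> 2"
  shows "pullback (tangent_atlas A) A fst (ext_deriv A \<eta>) \<in> ddB_exact_forms A q"
proof -
  obtain r where r: "q = Suc (Suc r)" using q by (metis add_2_eq_Suc le_Suc_ex)
  have \<eta>: "\<eta> \<in> forms A (Suc r)" using \<eta> by (simp add: r)
  define \<tau> where "\<tau> = tautological_contraction A \<eta>"
  let ?P = "pullback (tangent_atlas A) A fst \<eta>"
  have \<tau>: "\<tau> \<in> forms (tangent_atlas A) r" unfolding \<tau>_def by (rule tautological_forms[OF \<eta>])
  let ?\<beta> = "ext_deriv (tangent_atlas A) (d_B A \<tau>)"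
  have \<beta>: "?\<beta> \<in> ddB_exact_forms A q" using \<tau> by (auto simp: ddB_exact_forms_def r)
  have "?\<beta> = lincomb (real (Suc r)) 0 (ext_deriv (tangent_atlas A) ?P) (ext_deriv (tangent_atlas A) 0)"
    unfolding \<tau>_def d_B_tautological[OF \<eta>]
    by (rule ext_deriv_lincomb[OF TM.forms_differentiable[OF pullback_forms[OF \<eta>]]
          TM.forms_differentiable[OF TM.zero_forms]])
  then have "lincomb (1 / real (Suc r)) 0 ?\<beta> ?\<beta> = pullback (tangent_atlas A) A fst (ext_deriv A \<eta>)"
    using ext_deriv_pullback[OF \<eta>] by (simp add: lincomb_def del: of_nat_Suc)
  then show ?thesis using ddB_exact_lincomb[OF \<beta> \<beta>] by metis
qed

lemma ddB_class_pullback_eq: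
  assumes \<omega>: "\<omega> \<in> closed_forms A q" "\<omega>' \<in> closed_forms A q" and q: "q \<ge> 2"
    and eq: "de_rham_class A q \<omega> = de_rham_class A q \<omega>'"
  shows "ddB_class A q (pullback (tangent_atlas A) A fst \<omega>) =
    ddB_class A q (pullback (tangent_atlas A) A fst \<omega>')"
proof -
  obtain r where r: "q = Suc r" using q by (cases q) auto
  let ?P = "pullback (tangent_atlas A) A fst"
  let ?Z = "ddB_closed_forms A q" and ?N = "ddB_exact_forms A q"
  have "0 \<in> exact_forms A q"
    using zero_forms ext_deriv_zero by (auto simp: r exact_forms_def image_iff intro!: bexI[of _ 0])
  then have "\<omega>' \<in> de_rham_class A q \<omega>'"
    using \<omega> by (simp add: de_rham_class_def de_rham_rel_def mod_rel_def)
  then have "\<omega>' \<in> de_rham_class A q \<omega>" by (simp only: eq)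
  then have "\<omega> - \<omega>' \<in> exact_forms A q"
    by (simp add: de_rham_class_def de_rham_rel_def mod_rel_def)
  then obtain \<eta> where \<eta>: "\<eta> \<in> forms A (q - 1)" "\<omega> - \<omega>' = ext_deriv A \<eta>"
    by (auto simp: exact_forms_def r)
  have "?P \<omega> - ?P \<omega>' = ?P (\<omega> - \<omega>')"
    by (intro ext) (simp add: pullback_def)
  then have N: "?P \<omega> - ?P \<omega>' \<in> ?N" using pullback_exact[OF \<eta>(1) q] by (simp add: \<eta>(2))
  have diff: "\<alpha> - \<beta> \<in> ?N" "\<alpha> + \<beta> \<in> ?N" if "\<alpha> \<in> ?N" "\<beta> \<in> ?N" for \<alpha> \<beta>
  proof -
    have "\<alpha> - \<beta> = lincomb 1 (-1) \<alpha> \<beta>" "\<alpha> + \<beta> = lincomb 1 1 \<alpha> \<beta>"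
      by (auto simp: lincomb_def fun_eq_iff)
    then show "\<alpha> - \<beta> \<in> ?N" "\<alpha> + \<beta> \<in> ?N" using ddB_exact_lincomb[OF that] by metis+
  qed
  have "?P \<omega> - \<beta> \<in> ?N \<longleftrightarrow> ?P \<omega>' - \<beta> \<in> ?N" for \<beta>
  proof
    assume "?P \<omega> - \<beta> \<in> ?N"
    from diff(1)[OF this N] show "?P \<omega>' - \<beta> \<in> ?N" by simp
  next
    assume "?P \<omega>' - \<beta> \<in> ?N"
    from diff(2)[OF this N] show "?P \<omega> - \<beta> \<in> ?N" by simp
  qed
  then show ?thesis
    using pullback_closed[OF \<omega>(1)] pullback_closed[OF \<omega>(2)]
    by (auto simp: ddB_class_def ddB_rel_def mod_rel_def)
qed

end

text \<open>Uniqueness holds because every class is the class of a closed form and functions in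
  \<open>\<rightarrow>\<^sub>E\<close> are fixed outside their domain; for existence a representative of each class is chosen.\<close>

theorem theorem3:
  fixes m q :: nat and X :: "'p topology" and A :: "('p, 'e::real_inner) atlas"
  assumes "smooth_manifold m X A"
    and "q \<ge> 2"
  shows "\<exists>!f. f \<in> de_rham_cohomology A q \<rightarrow>\<^sub>E ddB_cohomology A q \<and>
    (\<forall>\<omega>\<in>closed_forms A q.
       f (de_rham_class A q \<omega>) = ddB_class A q (pullback (tangent_atlas A) A fst \<omega>))"
proof -
  interpret tangent_setting A
    by (rule tangent_settingI[OF smooth_manifold_imp_smooth_atlas[OF assms(1)]])
  let ?P = "pullback (tangent_atlas A) A fst"
  have classes: "de_rham_cohomology A q = de_rham_class A q ` closed_forms A q"
    by (auto simp: de_rham_cohomology_def de_rham_class_def quotient_def)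
  have target: "ddB_class A q (?P \<omega>) \<in> ddB_cohomology A q" if "\<omega> \<in> closed_forms A q" for \<omega>
    using pullback_closed[OF that] by (auto simp: ddB_cohomology_def ddB_class_def quotient_def)
  define f where "f = (\<lambda>K\<in>de_rham_cohomology A q.
    ddB_class A q (?P (inv_into (closed_forms A q) (de_rham_class A q) K)))"
  have f: "f (de_rham_class A q \<omega>) = ddB_class A q (?P \<omega>)" if "\<omega> \<in> closed_forms A q" for \<omega>
  proof -
    let ?K = "de_rham_class A q \<omega>"
    have K: "?K \<in> de_rham_class A q ` closed_forms A q" using that by simp
    show ?thesis
      using ddB_class_pullback_eq[OF inv_into_into[OF K] that assms(2) f_inv_into_f[OF K]] K
      by (simp add: f_def classes)
  qed
  show ?thesis
  proof (rule ex1I[of _ f])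
    show "f \<in> de_rham_cohomology A q \<rightarrow>\<^sub>E ddB_cohomology A q \<and>
        (\<forall>\<omega>\<in>closed_forms A q. f (de_rham_class A q \<omega>) = ddB_class A q (?P \<omega>))"
    proof
      show "f \<in> de_rham_cohomology A q \<rightarrow>\<^sub>E ddB_cohomology A q"
      proof (rule PiE_I)
        fix K assume "K \<in> de_rham_cohomology A q"
        then show "f K \<in> ddB_cohomology A q" using f target by (auto simp: classes)
      qed (simp add: f_def)
    qed (use f in blast)
  next
    fix g
    assume g: "g \<in> de_rham_cohomology A q \<rightarrow>\<^sub>E ddB_cohomology A q \<and>
        (\<forall>\<omega>\<in>closed_forms A q. g (de_rham_class A q \<omega>) = ddB_class A q (?P \<omega>))"
    show "g = f"
    proof
      fix K
      show "g K = f K"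
      proof (cases "K \<in> de_rham_cohomology A q")
        case True
        then show ?thesis using f g by (auto simp: classes)
      next
        case False
        then show ?thesis using PiE_arb[OF conjunct1[OF g] False] by (simp add: f_def)
      qed
    qed
  qed
qed

end
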